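(* Consider a BDL-tree that was created using only batch insertions and batch deletions, starting from an empty structure, and currently holding $n$ points. Then each batch of $B$ updates (a batch insertion of $B$ points or a batch deletion of $B$ points) takes $O(B\log^2(n+B))$ amortized work and $O(\log(n+B)\log\log(n+B))$ depth.
   Context: A BDL-tree storing points in $\mathbb{R}^d$ ($d$ constant) consists of a buffer $k$d-tree of capacity $X$ (a constant) and static $k$d-trees $T_0,T_1,\dots$, where $T_i$ has capacity $2^iX$ and is either empty or built (by median splitting, in the van Emde Boas layout) over its points. Let $F$ be the integer whose $i$-th bit is $1$ iff $T_i$ is nonempty. Batch insertion of a set $P$: first place $|P|\bmod X$ points into the buffer tree (if the buffer fills, its $X$ points are removed and added to $P$); then let $F_{new}=F+|P|/X$; each tree set in $F_{new}$ but not in $F$ is (in parallel) rebuilt from the points of the trees set in $F$ but not in $F_{new}$ that are merged into it, together with the required new points of $P$, and those smaller trees are emptied. Batch deletion of a set $P$: delete $P$ in parallel from every nonempty underlying tree (removing points from leaves and contracting emptied subtrees); then gather all points from any tree that has dropped below half of its original capacity, empty those trees, and reinsert the gathered points with batch insertion. A $k$d-tree over $m$ points with vEB layout can be built in $O(m\log m)$ work and $O(\log m\log\log m)$ depth. Complexity is in the work-depth model: work is the total number of operations, depth is the length of the longest chain of sequential dependencies; amortized work is averaged over the sequence of operations starting from an empty structure. *)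

theory Defs
  imports
    "HOL-Analysis.Finite_Cartesian_Product"
    "HOL-Library.Landau_Symbols"
    "HOL-Library.Log_Nat"
    "HOL-Library.Monad_Syntax"
    "HOL-Library.Multiset"
begin

section \<open>Work-depth cost model\<close>

text \<open>
  A computation is its result together with the number of operations it executes and the length
  of its longest chain of sequential dependencies. Each operation on a constant number of words
  (comparing two points, whose dimension is a constant; arithmetic on an index, on a counter or
  on the word \<open>F\<close>; following a pointer; setting a flag) is charged as one unit.
  Several branches may set the same flag.
\<close>

datatype 'a comp = Comp (val: 'a) (work: nat) (depth: nat)

definition ret :: "'a \<Rightarrow> 'a comp" where
  "ret x = Comp x 0 0"

definition bind_comp :: "'a comp \<Rightarrow> ('a \<Rightarrow> 'b comp) \<Rightarrow> 'b comp" where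
  "bind_comp c f =
     (let c' = f (val c) in Comp (val c') (work c + work c') (depth c + depth c'))"

adhoc_overloading Monad_Syntax.bind \<rightleftharpoons> bind_comp

definition tick :: "nat \<Rightarrow> unit comp" where
  "tick n = Comp () n n"

definition par :: "'a comp \<Rightarrow> 'b comp \<Rightarrow> ('a \<times> 'b) comp" where
  "par c c' = Comp (val c, val c') (1 + work c + work c') (1 + max (depth c) (depth c'))"

text \<open>
  A parallel loop spawns its iterations by a balanced binary tree of forks;
  \<open>floorlog 2 n\<close> is the number of binary digits of \<open>n\<close>.
\<close>

definition pmap :: "('a \<Rightarrow> 'b comp) \<Rightarrow> 'a list \<Rightarrow> 'b list comp" where
  "pmap f xs =
     Comp (map (\<lambda>x. val (f x)) xs)
       (1 + (\<Sum>x\<leftarrow>xs. 1 + work (f x)))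
       (1 + floorlog 2 (length xs) + Max (insert 0 ((\<lambda>x. depth (f x)) ` set xs)))"

text \<open>
  Lists play the role of arrays: taking a segment (\<^const>\<open>take\<close>, \<^const>\<open>drop\<close>) only computes indices
  and is free, while concatenation copies all elements in parallel, the target positions coming
  from prefix sums.
\<close>

definition pconcat :: "'a list list \<Rightarrow> 'a list comp" where
  "pconcat xss =
     (let m = length xss + length (concat xss) in Comp (concat xss) (1 + m) (1 + floorlog 2 m))"


section \<open>Static kd-trees\<close>

text \<open>
  Every node carries the address of its memory cell. An inner node splits along a coordinate axis
  at a given point; its right subtree holds the points that are not before that point.
\<close>

datatype ('p, 'k) kdtree =
    Leaf nat "'p list"
  | Node nat 'k 'p "('p, 'k) kdtree" "('p, 'k) kdtree"

text \<open>Points of \<open>real ^ 'd\<close>; the coordinate axes are indexed by \<open>'d\<close>.\<close>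

type_synonym 'd pt = "(real, 'd) vec"

text \<open>
  Ties in the splitting coordinate are broken lexicographically, so that a set of distinct points
  is always cut exactly at its median and a point determines its search path.
\<close>

definition before :: "'d \<Rightarrow> 'd::{finite,linorder} pt \<Rightarrow> 'd pt \<Rightarrow> bool" where
  "before k p q \<longleftrightarrow>
     p $ k < q $ k \<or>
     p $ k = q $ k \<and> (\<exists>j. p $ j < q $ j \<and> (\<forall>i<j. p $ i = q $ i))"

primrec addr :: "('p, 'k) kdtree \<Rightarrow> nat" where
  "addr (Leaf a ps) = a"
| "addr (Node a k s l r) = a"

primrec nodes :: "('p, 'k) kdtree \<Rightarrow> nat" where
  "nodes (Leaf a ps) = 1"
| "nodes (Node a k s l r) = 1 + nodes l + nodes r"

primrec height :: "('p, 'k) kdtree \<Rightarrow> nat" where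
  "height (Leaf a ps) = 1"
| "height (Node a k s l r) = 1 + max (height l) (height r)"

primrec points :: "('p, 'k) kdtree \<Rightarrow> 'p list" where
  "points (Leaf a ps) = ps"
| "points (Node a k s l r) = points l @ points r"

text \<open>Leaves hold at least one and at most \<open>b\<close> points; larger sets are split at a median.\<close>

primrec median_split :: "nat \<Rightarrow> ('d::{finite,linorder} pt, 'd) kdtree \<Rightarrow> bool" where
  "median_split b (Leaf a ps) \<longleftrightarrow> ps \<noteq> [] \<and> length ps \<le> b"
| "median_split b (Node a k s l r) \<longleftrightarrow>
     b < length (points l) + length (points r) \<and>
     length (points l) \<le> length (points r) + 1 \<and>
     length (points r) \<le> length (points l) + 1 \<and>
     (\<forall>p\<in>set (points l). before k p s) \<and>
     (\<forall>p\<in>set (points r). \<not> before k p s) \<and>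
     median_split b l \<and> median_split b r"

primrec subtrees_at :: "nat \<Rightarrow> ('p, 'k) kdtree \<Rightarrow> ('p, 'k) kdtree list" where
  "subtrees_at h (Leaf a ps) = (if h = 0 then [Leaf a ps] else [])"
| "subtrees_at h (Node a k s l r) =
     (if h = 0 then [Node a k s l r] else subtrees_at (h - 1) l @ subtrees_at (h - 1) r)"

text \<open>
  The addresses of the nodes on the top \<open>h\<close> levels of \<open>t\<close>, listed in van Emde Boas order: the
  upper half of the levels comes first, then one after the other the trees hanging below it.
\<close>

function veb_order :: "nat \<Rightarrow> ('p, 'k) kdtree \<Rightarrow> nat list" where
  "veb_order h t =
     (if h = 0 then []
      else if h = 1 then [addr t]
      else veb_order (h div 2) t @
           concat (map (veb_order (h - h div 2)) (subtrees_at (h div 2) t)))"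
  by pat_completeness auto
termination
  by (relation "measure fst") auto

definition veb_layout :: "('p, 'k) kdtree \<Rightarrow> bool" where
  "veb_layout t \<longleftrightarrow> veb_order (height t) t = [0..<nodes t]"

text \<open>
  A construction procedure for static kd-trees; the choice of the splitting axes is left open.
\<close>

type_synonym 'd builder = "'d pt list \<Rightarrow> ('d pt, 'd) kdtree comp"

definition kd_builder :: "nat \<Rightarrow> 'd::{finite,linorder} builder \<Rightarrow> bool" where
  "kd_builder b build \<longleftrightarrow>
     (\<forall>ps. ps \<noteq> [] \<and> distinct ps \<longrightarrow>
        mset (points (val (build ps))) = mset ps \<and>
        median_split b (val (build ps)) \<and>
        veb_layout (val (build ps)))"

definition build_opt :: "'d builder \<Rightarrow> 'd pt list \<Rightarrow> ('d pt, 'd) kdtree option comp" where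
  "build_opt build ps =
     (if ps = [] then ret None else do { t \<leftarrow> build ps; ret (Some t) })"

text \<open>
  Collecting the points of a tree. The results of the two branches are appended in constant time
  since the leaves can write directly to their final positions, which a preceding traversal of the
  same cost computes from the numbers of points in the subtrees.
\<close>

primrec gather :: "('p, 'k) kdtree \<Rightarrow> 'p list comp" where
  "gather (Leaf a ps) = do { tick (1 + length ps); ret ps }"
| "gather (Node a k s l r) = do {
     (xs, ys) \<leftarrow> par (gather l) (gather r);
     tick 1;
     ret (xs @ ys)
   }"

definition gather_opt :: "('p, 'k) kdtree option \<Rightarrow> 'p list comp" where
  "gather_opt to = (case to of None \<Rightarrow> ret [] | Some t \<Rightarrow> gather t)"

text \<open>
  Deletion of a batch from one tree. First all points of the batch descend the tree independently
  in parallel; a descent flags the nodes on its path (it returns their addresses) and the point it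
  finds in the leaf. Then one traversal of the flagged nodes removes the flagged points, drops
  emptied leaves and replaces each inner node that lost a child by its other child. The traversal
  also returns the number of removed points.
\<close>

primrec locate ::
  "'d::{finite,linorder} pt \<Rightarrow> ('d pt, 'd) kdtree \<Rightarrow> (nat list \<times> 'd pt list) comp"
where
  "locate p (Leaf a ps) = do { tick (1 + length ps); ret ([a], filter (\<lambda>q. q = p) ps) }"
| "locate p (Node a k s l r) = do {
     tick 1;
     (as, qs) \<leftarrow> (if before k p s then locate p l else locate p r);
     ret (a # as, qs)
   }"

fun join :: "nat \<Rightarrow> 'k \<Rightarrow> 'p \<Rightarrow> ('p, 'k) kdtree option \<Rightarrow> ('p, 'k) kdtree option
    \<Rightarrow> ('p, 'k) kdtree option" where
  "join a k s None r = r"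
| "join a k s l None = l"
| "join a k s (Some l) (Some r) = Some (Node a k s l r)"

primrec contract ::
  "nat set \<Rightarrow> 'p set \<Rightarrow> ('p, 'k) kdtree \<Rightarrow> (('p, 'k) kdtree option \<times> nat) comp"
where
  "contract M D (Leaf a ps) =
     (if a \<notin> M then do { tick 1; ret (Some (Leaf a ps), 0) }
      else do {
        tick (1 + length ps);
        let qs = filter (\<lambda>p. p \<notin> D) ps;
        ret (if qs = [] then None else Some (Leaf a qs), length ps - length qs)
      })"
| "contract M D (Node a k s l r) =
     (if a \<notin> M then do { tick 1; ret (Some (Node a k s l r), 0) }
      else do {
        ((l', m), (r', n)) \<leftarrow> par (contract M D l) (contract M D r);
        tick 1;
        ret (join a k s l' r', m + n)
      })"

definition erase ::
  "'d pt list \<Rightarrow> ('d::{finite,linorder} pt, 'd) kdtree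
    \<Rightarrow> (('d pt, 'd) kdtree option \<times> nat) comp"
where
  "erase P t = do {
     hits \<leftarrow> pmap (\<lambda>p. locate p t) P;
     contract (\<Union>(as, qs)\<in>set hits. set as) (\<Union>(as, qs)\<in>set hits. set qs) t
   }"


section \<open>BDL-trees\<close>

text \<open>
  Slot \<open>i\<close> holds the tree \<open>T\<^sub>i\<close> of capacity \<open>2 ^ i * X\<close>, together with its current number of
  points, or is empty.
\<close>

record 'd bdl =
  buffer :: "('d pt, 'd) kdtree option"
  slot :: "nat \<Rightarrow> (('d pt, 'd) kdtree \<times> nat) option"

definition empty_bdl :: "'d bdl" where
  "empty_bdl = \<lparr>buffer = None, slot = (\<lambda>_. None)\<rparr>"

definition opt_points :: "('p, 'k) kdtree option \<Rightarrow> 'p set" where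
  "opt_points to = (case to of None \<Rightarrow> {} | Some t \<Rightarrow> set (points t))"

definition contents :: "'d bdl \<Rightarrow> 'd pt set" where
  "contents s = opt_points (buffer s) \<union> (\<Union>i. opt_points (map_option fst (slot s i)))"

text \<open>The word \<open>F\<close>, which the structure maintains; only finitely many slots are ever nonempty.\<close>

definition flags :: "'d bdl \<Rightarrow> nat" where
  "flags s = (\<Sum>i | slot s i \<noteq> None. 2 ^ i)"

definition ones :: "nat \<Rightarrow> nat list" where
  "ones F = filter (bit F) [0..<floorlog 2 F]"

definition new_slots :: "nat \<Rightarrow> nat \<Rightarrow> nat list" where
  "new_slots F F' = filter (\<lambda>i. \<not> bit F i) (ones F')"

definition old_slots :: "nat \<Rightarrow> nat \<Rightarrow> nat list" where
  "old_slots F F' = filter (\<lambda>j. \<not> bit F' j) (ones F)"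

text \<open>
  A tree set in \<open>F\<close> but not in \<open>F'\<close> is merged into the next larger tree set in \<open>F'\<close> but not
  in \<open>F\<close>. The latter gets as many new points as its capacity exceeds the capacities of the trees
  merged into it.
\<close>

definition merged_into :: "nat \<Rightarrow> nat \<Rightarrow> nat \<Rightarrow> nat list" where
  "merged_into F F' i =
     filter (\<lambda>j. j < i \<and> (\<forall>i'\<in>set (new_slots F F'). j < i' \<longrightarrow> i \<le> i')) (old_slots F F')"

definition required :: "nat \<Rightarrow> nat \<Rightarrow> nat \<Rightarrow> nat \<Rightarrow> nat" where
  "required X F F' i = (2 ^ i - (\<Sum>j\<leftarrow>merged_into F F' i. 2 ^ j)) * X"

definition share :: "nat \<Rightarrow> nat \<Rightarrow> nat \<Rightarrow> 'p list \<Rightarrow> nat \<Rightarrow> 'p list" where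
  "share X F F' P i =
     take (required X F F' i)
       (drop (\<Sum>i'\<leftarrow>filter (\<lambda>i'. i' < i) (new_slots F F'). required X F F' i') P)"

text \<open>
  The first stage of an insertion returns the new buffer tree (rebuilt if it changes) and the
  points that go to the static trees; their number is a multiple of \<open>X\<close>.
\<close>

definition fill_buffer ::
  "'d builder \<Rightarrow> nat \<Rightarrow> 'd pt list \<Rightarrow> 'd bdl
    \<Rightarrow> (('d pt, 'd) kdtree option \<times> 'd pt list) comp"
where
  "fill_buffer build X P s =
     (let r = length P mod X in
      if r = 0 then do { tick 1; ret (buffer s, P) }
      else do {
        tick 1;
        old \<leftarrow> gather_opt (buffer s);
        Q \<leftarrow> pconcat [old, take r P];
        if length Q < X then do {
          buf \<leftarrow> build_opt build Q;
          ret (buf, drop r P)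
        } else do {
          buf \<leftarrow> build_opt build (drop X Q);
          P' \<leftarrow> pconcat [drop r P, take X Q];
          ret (buf, P')
        }
      })"

text \<open>
  The first \<^const>\<open>tick\<close> after computing \<open>F'\<close> pays for a scan over the binary digits of \<open>F\<close> and \<open>F'\<close>
  that determines which trees are merged and the segments of the new points.
\<close>

definition batch_insert ::
  "'d builder \<Rightarrow> nat \<Rightarrow> 'd pt list \<Rightarrow> 'd bdl \<Rightarrow> 'd bdl comp"
where
  "batch_insert build X P s = do {
     (buf, P') \<leftarrow> fill_buffer build X P s;
     let F = flags s;
     let F' = F + length P' div X;
     tick (1 + floorlog 2 F');
     built \<leftarrow> pmap (\<lambda>i. do {
         olds \<leftarrow> pmap (\<lambda>j. gather_opt (map_option fst (slot s j))) (merged_into F F' i);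
         Q \<leftarrow> pconcat (olds @ [share X F F' P' i]);
         t \<leftarrow> build Q;
         ret (i, (t, length Q))
       }) (new_slots F F');
     ret \<lparr>buffer = buf,
          slot = (\<lambda>i. if i \<in> set (old_slots F F') then None
                      else if i \<in> set (new_slots F F') then map_of built i
                      else slot s i)\<rparr>
   }"

definition erase_buffer ::
  "'d pt list \<Rightarrow> ('d::{finite,linorder} pt, 'd) kdtree option
    \<Rightarrow> ('d pt, 'd) kdtree option comp"
where
  "erase_buffer P to =
     (case to of None \<Rightarrow> ret None | Some t \<Rightarrow> do { (t', m) \<leftarrow> erase P t; ret t' })"

text \<open>Yields the index, the remaining tree and the remaining number of points.\<close>

definition erase_slot ::
  "'d pt list \<Rightarrow> 'd::{finite,linorder} bdl \<Rightarrow> nat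
    \<Rightarrow> (nat \<times> ('d pt, 'd) kdtree option \<times> nat) comp"
where
  "erase_slot P s i =
     (case slot s i of
        None \<Rightarrow> ret (i, None, 0)
      | Some (t, c) \<Rightarrow> do { (t', m) \<leftarrow> erase P t; tick 1; ret (i, t', c - m) })"

definition batch_delete ::
  "'d::{finite,linorder} builder \<Rightarrow> nat \<Rightarrow> 'd pt list \<Rightarrow> 'd bdl \<Rightarrow> 'd bdl comp"
where
  "batch_delete build X P s = do {
     let F = flags s;
     tick (1 + floorlog 2 F);
     (buf, rest) \<leftarrow> par (erase_buffer P (buffer s)) (pmap (erase_slot P s) (ones F));
     tick (1 + length rest);
     let low = filter (\<lambda>(i, t, c). 2 * c < 2 ^ i * X) rest;
     let high = filter (\<lambda>(i, t, c). \<not> 2 * c < 2 ^ i * X) rest;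
     gathered \<leftarrow> pmap (\<lambda>(i, t, c). gather_opt t) low;
     Q \<leftarrow> pconcat gathered;
     batch_insert build X Q
       \<lparr>buffer = buf,
        slot = (\<lambda>i. case map_of high i of
                      Some (Some t, c) \<Rightarrow> Some (t, c)
                    | _ \<Rightarrow> None)\<rparr>
   }"


section \<open>Sequences of batch updates\<close>

datatype 'd update = Insertion (batch: "'d pt list") | Deletion (batch: "'d pt list")

primrec exec ::
  "'d::{finite,linorder} builder \<Rightarrow> nat \<Rightarrow> 'd update \<Rightarrow> 'd bdl \<Rightarrow> 'd bdl comp"
where
  "exec build X (Insertion P) s = batch_insert build X P s"
| "exec build X (Deletion P) s = batch_delete build X P s"

definition state_before ::
  "'d::{finite,linorder} builder \<Rightarrow> nat \<Rightarrow> 'd update list \<Rightarrow> nat \<Rightarrow> 'd bdl"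
where
  "state_before build X us i = fold (\<lambda>u s. val (exec build X u s)) (take i us) empty_bdl"

text \<open>
  Batches are nonempty sets of points. The structure stores a set: inserted points are not yet
  present. Deleted points may be absent.
\<close>

definition admissible :: "'d::{finite,linorder} update \<Rightarrow> 'd bdl \<Rightarrow> bool" where
  "admissible u s \<longleftrightarrow>
     batch u \<noteq> [] \<and> distinct (batch u) \<and>
     (case u of Insertion P \<Rightarrow> set P \<inter> contents s = {} | Deletion P \<Rightarrow> True)"

text \<open>
  The binary logarithm, kept away from the arguments \<open>m < 4\<close> for which \<open>log m\<close> or
  \<open>log (log m)\<close> is undefined or too small to bound a positive cost; it equals \<open>log 2 m\<close> for all
  \<open>m \<ge> 4\<close>.
\<close>

definition lg :: "nat \<Rightarrow> real" where
  "lg m = log 2 (max 4 (real m))"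

end

(*
  The structure is a binary counter F whose bit i, when it is set, costs O(2^i * (i + 1)) for
  building a tree of capacity 2^i * X. Level i is prepaid by 2 * (F mod 2^i) - 2^i units (zero if
  negative) of size i + 1: adding k to F raises this credit by at most 2 * k minus the 2^i units
  spent if bit i becomes set, and clearing bits never raises it. As only the levels up to log F
  hold credit, inserting k * X points costs O(k * log^2 F) amortized.

  Deletions are paid by the deficit, the total capacity of the trees minus the number of their
  points. Merging preserves it, deleting m points adds at most m, and a tree that falls below half
  full gives back at least as much deficit as points to be reinserted. A unit of deficit carries
  potential w(F) = (1 + log (F + 1))^2; as the deficit is at most X * F and
  F * (w(F + k) - w(F)) = O(k * w(F + k)), the growth of w during an insertion is paid by the
  inserted points, while a deletion never increases F.

  Trees stay at least half full, so F is linear in the number of points, and their heights do not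
  grow after construction, which gives the depth bound. That searches find their points is
  irrelevant for the costs; but the addresses of a tree must be distinct, which follows from the
  van Emde Boas layout, since otherwise deletion would visit nodes off the search paths.
*)

theory Submission
  imports
    Defs
    "HOL-Library.Nat_Bijection"
    "HOL-Library.Sublist"
begin

section \<open>Static trees\<close>

text \<open>The plain residue \<open>F mod 2 ^ i\<close> would also pay for setting bit
  \<open>i\<close>, since this bit changes only by a carry out of the lower bits or by an addition
  of at least \<open>2 ^ i\<close>. But on every level above the top bit the residue equals
  \<open>F\<close>, so infinitely many levels would hold credit. Doubling it and subtracting
  \<open>2 ^ i\<close> makes those levels vanish.

  Deletions cannot simply be charged to the tree that they hit: before it falls below half it may
  have been merged into a larger tree. The deficit survives a merge because the new points fill
  exactly the capacity that the merged trees do not account for. It is spent at an unknown later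
  time, possibly under a much larger counter, so a price fixed at the moment of the deletion would
  be too low; the price has to follow \<open>F\<close>.\<close>

lemma comp_ret [simp]: "val (ret x) = x" "work (ret x) = 0" "depth (ret x) = 0"
  by (simp_all add: ret_def)

lemma comp_bind [simp]:
  "val (bind_comp c f) = val (f (val c))"
  "work (bind_comp c f) = work c + work (f (val c))"
  "depth (bind_comp c f) = depth c + depth (f (val c))"
  by (simp_all add: bind_comp_def Let_def)

lemma comp_tick [simp]: "work (tick n) = n" "depth (tick n) = n"
  by (simp_all add: tick_def)

lemma comp_par [simp]:
  "val (par c c') = (val c, val c')"
  "work (par c c') = 1 + work c + work c'"
  "depth (par c c') = 1 + max (depth c) (depth c')"
  by (simp_all add: par_def)

lemma comp_pmap [simp]:
  "val (pmap f xs) = map (\<lambda>x. val (f x)) xs"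
  "work (pmap f xs) = 1 + (\<Sum>x\<leftarrow>xs. 1 + work (f x))"
  by (simp_all add: pmap_def)

lemma depth_pmap_le:
  assumes "\<And>x. x \<in> set xs \<Longrightarrow> depth (f x) \<le> m"
  shows "depth (pmap f xs) \<le> 1 + floorlog 2 (length xs) + m"
  using assms by (auto simp: pmap_def)

lemma comp_pconcat [simp]:
  "val (pconcat xss) = concat xss"
  "work (pconcat xss) = 2 + length xss + length (concat xss) - 1"
  "depth (pconcat xss) = 1 + floorlog 2 (length xss + length (concat xss))"
  by (simp_all add: pconcat_def Let_def)

section \<open>Node addresses and the van Emde Boas order\<close>

primrec addrs :: "('p, 'k) kdtree \<Rightarrow> nat list" where
  "addrs (Leaf a ps) = [a]"
| "addrs (Node a k s l r) = a # addrs l @ addrs r"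

text \<open>The yardstick for \<open>veb_order\<close>: the same addresses in preorder, without the
  recursion that halves the number of levels.\<close>

primrec top_addrs :: "nat \<Rightarrow> ('p, 'k) kdtree \<Rightarrow> nat list" where
  "top_addrs h (Leaf a ps) = (if h = 0 then [] else [a])"
| "top_addrs h (Node a k s l r) =
     (if h = 0 then [] else a # top_addrs (h - 1) l @ top_addrs (h - 1) r)"

lemma top_addrs_0 [simp]: "top_addrs 0 t = []"
  by (cases t) auto

lemma top_addrs_1: "top_addrs (Suc 0) t = [addr t]"
  by (cases t) auto

lemma subtrees_at_0 [simp]: "subtrees_at 0 t = [t]"
  by (cases t) auto

lemma top_addrs_full: "height t \<le> h \<Longrightarrow> top_addrs h t = addrs t"
  by (induction t arbitrary: h) auto

text \<open>The levels can be cut at any \<open>h\<close>, so the induction for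
  \<open>veb_order\<close> does not depend on where it halves. Branches that end above the cut yield
  no subtree, and they contribute nothing below it.\<close>

lemma mset_top_addrs_add:
  "mset (top_addrs (h + h') t) =
     mset (top_addrs h t) + (\<Sum>s\<leftarrow>subtrees_at h t. mset (top_addrs h' s))"
proof (induction t arbitrary: h)
  case (Leaf a ps)
  then show ?case by auto
next
  case (Node a k s l r)
  then show ?case
    by (cases h) auto
qed

lemma mset_veb_order: "mset (veb_order h t) = mset (top_addrs h t)"
proof (induction h t rule: veb_order.induct)
  case (1 h t)
  consider "h = 0" | "h = 1" | "h \<ge> 2" by linarith
  then show ?case
  proof cases
    case 3
    have "mset (veb_order h t) = mset (veb_order (h div 2) t)
        + (\<Sum>s\<leftarrow>subtrees_at (h div 2) t. mset (veb_order (h - h div 2) s))"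
      using 3 by (subst veb_order.simps) (simp add: mset_concat comp_def del: veb_order.simps)
    also have "\<dots> = mset (top_addrs (h div 2) t)
        + (\<Sum>s\<leftarrow>subtrees_at (h div 2) t. mset (top_addrs (h - h div 2) s))"
      using 1 3 by (simp del: veb_order.simps cong: map_cong)
    also have "\<dots> = mset (top_addrs (h div 2 + (h - h div 2)) t)"
      by (rule mset_top_addrs_add [symmetric])
    finally show ?thesis by simp
  qed (auto simp: top_addrs_1)
qed

text \<open>Listing \<open>height t\<close> levels covers the whole tree, so the layout makes the
  addresses a permutation of \<open>[0..<nodes t]\<close>.\<close>

lemma veb_layout_distinct_addrs:
  assumes "veb_layout t"
  shows "distinct (addrs t)"
proof -
  have "mset (addrs t) = mset [0..<nodes t]"
    using assms mset_veb_order [of "height t" t] top_addrs_full [of t "height t"]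
    unfolding veb_layout_def by (simp del: veb_order.simps)
  then show ?thesis
    by (metis distinct_upt mset_eq_imp_distinct_iff)
qed

text \<open>The part of \<open>median_split\<close> that survives deletions: contraction ruins the
  balance, but leaves only shrink and empty ones disappear. Nonempty leaves keep the number of nodes
  linear in the number of points.\<close>

primrec leaves_within :: "nat \<Rightarrow> ('p, 'k) kdtree \<Rightarrow> bool" where
  "leaves_within b (Leaf a ps) \<longleftrightarrow> ps \<noteq> [] \<and> length ps \<le> b"
| "leaves_within b (Node a k s l r) \<longleftrightarrow> leaves_within b l \<and> leaves_within b r"

lemma median_split_leaves_within: "median_split b t \<Longrightarrow> leaves_within b t"
  by (induction t) auto

text \<open>Sizes of siblings differ by at most one, so at most \<open>2 ^ Suc h'\<close> points
  split into two parts of at most \<open>2 ^ h'\<close>; rounding is harmless because the bound is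
  even. With \<open>0 < b\<close> an inner node has at least two points, which excludes
  \<open>h = 0\<close>.\<close>

lemma median_split_height:
  assumes "median_split b t" "0 < b" "length (points t) \<le> 2 ^ h"
  shows "height t \<le> Suc h"
  using assms
proof (induction t arbitrary: h)
  case (Node a k s l r)
  then have "2 \<le> (2::nat) ^ h" by simp
  then obtain h' where h': "h = Suc h'" by (cases h) auto
  have "length (points l) \<le> 2 ^ h'" "length (points r) \<le> 2 ^ h'"
    using Node.prems by (auto simp: h')
  then show ?case using Node by (simp add: h')
qed simp

text \<open>The bound \<open>h\<close> is fixed at construction and merely kept by deletions.
  Distinct addresses bound the number of visited nodes; distinct points let removals be counted by
  cardinalities.\<close>

definition sound :: "nat \<Rightarrow> nat \<Rightarrow> ('p, 'k) kdtree \<Rightarrow> bool" where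
  "sound b h t \<longleftrightarrow>
     leaves_within b t \<and> distinct (addrs t) \<and> distinct (points t) \<and> height t \<le> h"

lemma kd_builder_sound:
  assumes "kd_builder b build" "0 < b" "ps \<noteq> []" "distinct ps" "length ps \<le> 2 ^ h"
  shows "sound b (Suc h) (val (build ps))"
proof -
  have m: "mset (points (val (build ps))) = mset ps" "median_split b (val (build ps))"
    "veb_layout (val (build ps))"
    using assms unfolding kd_builder_def by auto
  have len: "length (points (val (build ps))) = length ps"
    using m(1) by (rule mset_eq_length)
  show "sound b (Suc h) (val (build ps))"
    unfolding sound_def
    using m assms len median_split_height [of b "val (build ps)" h]
    by (auto intro: veb_layout_distinct_addrs median_split_leaves_within
        simp: mset_eq_imp_distinct_iff [OF m(1)])
qed

section \<open>Cost and effect of gathering, searching and contracting\<close>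

definition points_opt :: "('p, 'k) kdtree option \<Rightarrow> 'p list" where
  "points_opt to = (case to of None \<Rightarrow> [] | Some t \<Rightarrow> points t)"

lemma points_opt_simps [simp]: "points_opt None = []" "points_opt (Some t) = points t"
  by (simp_all add: points_opt_def)

lemma opt_points_eq: "opt_points to = set (points_opt to)"
  by (cases to) (simp_all add: opt_points_def)

lemma val_gather [simp]: "val (gather t) = points t"
  by (induction t) auto

text \<open>Leaves are nonempty, so there are fewer inner nodes than points. The slack of 2 carries
  the induction: two children release 4, of which 2 pay for their parent and 2 remain.\<close>

lemma work_gather: "leaves_within b t \<Longrightarrow> work (gather t) + 2 \<le> 4 * length (points t)"
proof (induction t)
  case (Leaf a ps)
  then show ?case by (cases ps) auto
qed auto

lemma depth_gather: "leaves_within b t \<Longrightarrow> depth (gather t) \<le> 2 * height t + b"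
  by (induction t) auto

lemma gather_opt_bounds:
  assumes "pred_option (sound b h) to"
  shows "val (gather_opt to) = points_opt to"
    and "work (gather_opt to) \<le> 4 * length (points_opt to)"
    and "depth (gather_opt to) \<le> 2 * h + b"
  using assms work_gather [of b "the to"] depth_gather [of b "the to"]
  by (cases to; force simp: gather_opt_def sound_def)+

lemma locate_bounds:
  assumes "leaves_within b t"
  shows "work (locate p t) \<le> height t + b" and "depth (locate p t) \<le> height t + b"
    and "length (fst (val (locate p t))) \<le> height t"
    and "set (snd (val (locate p t))) \<subseteq> {p}"
  using assms by (induction t) (auto simp: case_prod_beta)

lemma join_cases:
  "join a k s l r = (case l of None \<Rightarrow> r | Some l' \<Rightarrow>
     (case r of None \<Rightarrow> l | Some r' \<Rightarrow> Some (Node a k s l' r')))"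
  by (cases l; cases r) auto

definition addrs_opt :: "('p, 'k) kdtree option \<Rightarrow> nat list" where
  "addrs_opt to = (case to of None \<Rightarrow> [] | Some t \<Rightarrow> addrs t)"

text \<open>\<open>subseq\<close> is compatible with appending and yields both distinctness and
  inclusion, which is what soundness of the contracted tree needs.\<close>

lemma contract_structure:
  assumes "leaves_within b t"
  shows "pred_option (leaves_within b) (fst (val (contract M D t))) \<and>
    pred_option (\<lambda>t'. height t' \<le> height t) (fst (val (contract M D t))) \<and>
    subseq (addrs_opt (fst (val (contract M D t)))) (addrs t) \<and>
    subseq (points_opt (fst (val (contract M D t)))) (points t)"
  using assms
proof (induction t)
  case (Leaf a ps)
  then show ?case
    by (auto simp: Let_def addrs_opt_def le_trans [OF length_filter_le])
next
  case (Node a k s l r)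
  then show ?case
    by (auto simp: join_cases case_prod_beta addrs_opt_def points_opt_def
        intro: list_emb_append_mono subseq_Cons' list_emb_prefix list_emb_append2
        split: option.splits)
qed

text \<open>The equation keeps the stored sizes exact. The second part is an inequality because
  points of \<open>D\<close> in unflagged leaves stay.\<close>

lemma contract_removed:
  "length (points_opt (fst (val (contract M D t)))) + snd (val (contract M D t)) =
     length (points t) \<and>
   snd (val (contract M D t)) \<le> length (filter (\<lambda>p. p \<in> D) (points t))"
proof (induction t)
  case (Leaf a ps)
  show ?case
    using sum_length_filter_compl [of "\<lambda>p. p \<in> D" ps] by (auto simp: Let_def)
next
  case (Node a k s l r)
  then show ?case
    by (auto simp: join_cases case_prod_beta points_opt_def split: option.splits)
qed

text \<open>An unflagged node stops the traversal at unit cost, which is charged to its flagged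
  parent. An inner node then accounts for at most 3 units and a leaf for at most \<open>b\<close>;
  the leading 1 covers an unflagged root.\<close>

lemma work_contract:
  assumes "leaves_within b t"
  shows "work (contract M D t) \<le> 1 + (b + 3) * length (filter (\<lambda>a. a \<in> M) (addrs t))"
  using assms
proof (induction t)
  case (Leaf a ps)
  then show ?case by (auto simp: Let_def)
next
  case (Node a k s l r)
  then show ?case by (auto simp: case_prod_beta algebra_simps)
qed

lemma depth_contract: "leaves_within b t \<Longrightarrow> depth (contract M D t) \<le> 2 * height t + b"
  by (induction t) (auto simp: Let_def case_prod_beta)

lemma length_filter_distinct_le:
  assumes "distinct xs" "finite A"
  shows "length (filter (\<lambda>x. x \<in> A) xs) \<le> card A"
proof -
  have "length (filter (\<lambda>x. x \<in> A) xs) = card (set (filter (\<lambda>x. x \<in> A) xs))"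
    using assms(1) by (metis distinct_card distinct_filter)
  also have "\<dots> \<le> card A"
    using assms(2) by (intro card_mono) auto
  finally show ?thesis .
qed

lemma subseq_imp_distinct: "subseq xs ys \<Longrightarrow> distinct ys \<Longrightarrow> distinct xs"
  by (auto simp: subseq_conv_nths intro: distinct_nthsI)

lemma subseq_imp_subset: "subseq xs ys \<Longrightarrow> set xs \<subseteq> set ys"
  by (auto simp: subseq_conv_nths dest: in_set_nthsD)

text \<open>Removals are bounded by the points that \<open>P\<close> and the tree share, not by
  \<open>length P\<close>: summed over trees with disjoint points, this charges each deleted point
  only once.\<close>

lemma erase_result:
  assumes "sound b h t"
  shows "pred_option (sound b h) (fst (val (erase P t)))"
    and "set (points_opt (fst (val (erase P t)))) \<subseteq> set (points t)"
    and "length (points_opt (fst (val (erase P t)))) + snd (val (erase P t)) = length (points t)"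
    and "snd (val (erase P t)) \<le> card (set P \<inter> set (points t))"
proof -
  define hits where "hits = map (\<lambda>p. val (locate p t)) P"
  define M where "M = (\<Union>(as, qs)\<in>set hits. set as)"
  define D where "D = (\<Union>(as, qs)\<in>set hits. set qs)"
  have v: "val (erase P t) = val (contract M D t)"
    by (simp add: erase_def hits_def M_def D_def)
  have lw: "leaves_within b t" using assms by (simp add: sound_def)
  show "pred_option (sound b h) (fst (val (erase P t)))"
    using contract_structure [OF lw, of M D] assms
    unfolding v sound_def
    by (cases "fst (val (contract M D t))") (auto simp: addrs_opt_def dest: subseq_imp_distinct)
  show "set (points_opt (fst (val (erase P t)))) \<subseteq> set (points t)"
    using contract_structure [OF lw, of M D] unfolding v
    by (blast dest: subseq_imp_subset)
  show "length (points_opt (fst (val (erase P t)))) + snd (val (erase P t)) = length (points t)"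
    using contract_removed [of M D t] by (simp add: v)
  have "D \<subseteq> set P"
    using locate_bounds(4) [OF lw] by (fastforce simp: D_def hits_def case_prod_beta)
  then have "filter (\<lambda>p. p \<in> D) (points t) = filter (\<lambda>p. p \<in> D \<inter> set P) (points t)"
    by (intro filter_cong) auto
  then have "snd (val (erase P t)) \<le> card (set (filter (\<lambda>p. p \<in> D \<inter> set P) (points t)))"
    using contract_removed [of M D t] assms
    by (simp add: v sound_def distinct_card del: set_filter)
  also have "\<dots> \<le> card (set P \<inter> set (points t))"
    by (intro card_mono) auto
  finally show "snd (val (erase P t)) \<le> card (set P \<inter> set (points t))" .
qed

lemma work_erase:
  assumes "sound b h t" "P \<noteq> []"
  shows "work (erase P t) \<le> (b + 4) * (h + 1) * length P"
proof -
  define hits where "hits = map (\<lambda>p. val (locate p t)) P"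
  define M where "M = (\<Union>(as, qs)\<in>set hits. set as)"
  define D where "D = (\<Union>(as, qs)\<in>set hits. set qs)"
  have lw: "leaves_within b t" and ht: "height t \<le> h" and da: "distinct (addrs t)"
    using assms by (auto simp: sound_def)
  have fin: "finite M" by (auto simp: M_def)
  have "M = set (concat (map (\<lambda>p. fst (val (locate p t))) P))"
    by (force simp: M_def hits_def case_prod_beta)
  then have "card M \<le> (\<Sum>p\<leftarrow>P. length (fst (val (locate p t))))"
    by (metis (no_types, lifting) card_length length_concat map_map comp_def map_cong)
  also have "\<dots> \<le> (\<Sum>p\<leftarrow>P. h)"
    using locate_bounds(3) [OF lw] ht by (intro sum_list_mono) (meson order_trans)
  finally have M: "card M \<le> length P * h" by (simp add: sum_list_triv)
  \<comment> \<open>Here distinct addresses turn the number of flagged nodes into the size of the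
    union of the search paths.\<close>
  have "work (contract M D t) \<le> 1 + (b + 3) * card M"
    using work_contract [OF lw, of M D] length_filter_distinct_le [OF da fin]
    by (meson add_left_mono mult_le_mono2 order_trans)
  also have "\<dots> \<le> 1 + (b + 3) * (length P * h)"
    using M by (intro add_left_mono mult_left_mono) auto
  finally have c: "work (contract M D t) \<le> 1 + (b + 3) * (length P * h)" .
  have "(\<Sum>p\<leftarrow>P. 1 + work (locate p t)) \<le> (\<Sum>p\<leftarrow>P. 1 + (h + b))"
    using locate_bounds(1) [OF lw] ht by (intro sum_list_mono) (meson add_le_mono order_trans le_refl)
  then have l: "(\<Sum>p\<leftarrow>P. 1 + work (locate p t)) \<le> length P * (1 + h + b)"
    by (simp add: sum_list_triv)
  have "work (erase P t) = 1 + (\<Sum>p\<leftarrow>P. 1 + work (locate p t)) + work (contract M D t)"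
    by (simp add: erase_def hits_def M_def D_def)
  also have "\<dots> \<le> 2 * length P + length P * (1 + h + b) + (b + 3) * (length P * h) "
  proof -
    \<comment> \<open>A nonempty batch absorbs the unit costs of the loop and of the root.\<close>
    have "1 \<le> length P" using assms(2) by (cases P) auto
    then show ?thesis using c l by linarith
  qed
  also have "\<dots> \<le> (b + 4) * (h + 1) * length P"
    by (simp add: algebra_simps)
  finally show ?thesis .
qed

lemma depth_erase:
  assumes "sound b h t"
  shows "depth (erase P t) \<le> 1 + floorlog 2 (length P) + 3 * h + 2 * b"
proof -
  have lw: "leaves_within b t" and ht: "height t \<le> h"
    using assms by (auto simp: sound_def)
  have d: "depth (pmap (\<lambda>p. locate p t) P) \<le> 1 + floorlog 2 (length P) + (h + b)"
    using locate_bounds(2) [OF lw] ht by (intro depth_pmap_le) (meson add_le_mono order_trans le_refl)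
  have "depth (pmap (\<lambda>p. locate p t) P) + depth (contract M D t)
      \<le> 1 + floorlog 2 (length P) + 3 * h + 2 * b" for M D
  proof -
    have "depth (contract M D t) \<le> 2 * h + b"
      using depth_contract [OF lw, of M D] ht by simp
    then show ?thesis using d by linarith
  qed
  then show ?thesis by (simp add: erase_def)
qed

lemma floorlog2_le: "floorlog 2 n \<le> n"
  by (rule floorlog_leI) auto

text \<open>Crude: each added unit costs at most one digit. It moves small summands, such as the
  number of lists that \<open>pconcat\<close> joins, out of the logarithm.\<close>

lemma floorlog2_add_le: "floorlog 2 (m + n) \<le> floorlog 2 m + n"
proof (rule floorlog_leI)
  have "m + n < 2 ^ floorlog 2 m + n"
    using floorlog_bounds [of m 2] by (cases "m = 0") auto
  also have "\<dots> \<le> 2 ^ floorlog 2 m * (1 + n)"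
    by simp
  also have "\<dots> \<le> 2 ^ floorlog 2 m * 2 ^ n"
    by (intro mult_left_mono) (auto simp: Suc_le_eq)
  finally show "m + n < 2 ^ (floorlog 2 m + n)" by (simp add: power_add)
qed auto

section \<open>The binary counter\<close>

lemma floorlog2_gt_bit:
  fixes F :: nat
  assumes "bit F i"
  shows "i < floorlog 2 F"
proof -
  have "2 ^ i \<le> F"
    using assms by (metis bit_iff_odd div_less even_zero linorder_not_less)
  then show ?thesis
    using floorlog_geI [of 2 "Suc i" F] by simp
qed

lemma less_two_power_floorlog: "F < 2 ^ floorlog 2 F" for F :: nat
  using floorlog_bounds [of F 2] by (cases "F = 0") auto

lemma set_ones: "set (ones F) = {i. bit F i}"
  using floorlog2_gt_bit by (auto simp: ones_def)

lemma distinct_ones [simp]: "distinct (ones F)"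
  by (simp add: ones_def)

lemma length_ones: "length (ones F) \<le> floorlog 2 F"
  unfolding ones_def by (metis length_filter_le length_upt minus_nat.diff_0)

lemma set_new_slots: "set (new_slots F F') = {i. bit F' i \<and> \<not> bit F i}"
  by (auto simp: new_slots_def set_ones)

lemma set_old_slots: "set (old_slots F F') = {i. bit F i \<and> \<not> bit F' i}"
  by (auto simp: old_slots_def set_ones)

lemma distinct_slots [simp]: "distinct (new_slots F F')" "distinct (old_slots F F')"
  "distinct (merged_into F F' i)"
  by (simp_all add: new_slots_def old_slots_def merged_into_def)

lemma length_new_slots: "length (new_slots F F') \<le> floorlog 2 F'"
  unfolding new_slots_def using length_filter_le length_ones order_trans by blast

lemma finite_bits [simp]: "finite {i. bit (F::nat) i}"
  by (metis List.finite_set set_ones)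

text \<open>\<open>set_decode\<close> is inverse to summing powers of two, so facts on finite sets
  as binary representations become facts on \<open>bit\<close>.\<close>

lemma set_decode_eq: "set_decode F = {i. bit F i}"
  by (simp add: set_decode_def bit_iff_odd)

lemma sum_bits: "(\<Sum>i | bit F i. 2 ^ i) = (F::nat)"
  using set_decode_inverse [of F] by (simp add: set_decode_eq set_encode_def)

lemma bit_sum_iff:
  assumes "finite A"
  shows "bit (\<Sum>i\<in>A. 2 ^ i :: nat) i \<longleftrightarrow> i \<in> A"
  using set_encode_inverse [OF assms] by (auto simp: set_decode_eq set_encode_def)

lemma sum_two_power_less:
  fixes i :: nat
  assumes "\<And>j. j \<in> A \<Longrightarrow> j < i"
  shows "(\<Sum>j\<in>A. 2 ^ j) < (2::nat) ^ i"
proof -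
  have "(\<Sum>j\<in>A. 2 ^ j) \<le> (\<Sum>j<i. 2 ^ j :: nat)"
    using assms by (intro sum_mono2) auto
  also have "\<dots> < 2 ^ i"
    by (induction i) auto
  finally show ?thesis .
qed

section \<open>Credit of the binary counter\<close>

definition level_credit :: "nat \<Rightarrow> nat \<Rightarrow> nat" where
  "level_credit i F = 2 * (F mod 2 ^ i) - 2 ^ i"

text \<open>If \<open>k\<close> is at least \<open>2 ^ i\<close>, the payment \<open>2 * k\<close>
  alone covers the bit and any possible credit. For smaller \<open>k\<close> the bit can change only
  when the residue wraps around.\<close>

lemma level_credit_add:
  "level_credit i (F + k) + (if bit (F + k) i \<and> \<not> bit F i then 2 ^ i else 0) \<le> level_credit i F + 2 * k"
proof -
  define m :: nat where "m = 2 ^ i"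
  have m: "0 < m" by (simp add: m_def)
  have bits: "bit F i \<longleftrightarrow> odd (F div m)" "bit (F + k) i \<longleftrightarrow> odd ((F + k) div m)"
    by (simp_all add: bit_iff_odd m_def)
  have lt: "(F + k) mod m < m" "F mod m < m" using m by simp_all
  show ?thesis
  proof (cases "m \<le> k")
    case True
    then show ?thesis using lt(1) unfolding level_credit_def m_def [symmetric] by (simp split: if_splits; linarith)
  next
    case False
    show ?thesis
    proof (cases "F mod m + k < m")
      case True
      have "(F + k) div m = F div m" "(F + k) mod m = F mod m + k"
      proof -
        have eq: "F + k = (F mod m + k) + F div m * m" by simp
        show "(F + k) div m = F div m"
          by (subst eq, subst div_mult_self1) (use True m in auto)
        show "(F + k) mod m = F mod m + k"
          by (subst eq, subst mod_mult_self1) (use True in auto)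
      qed
      then show ?thesis by (simp add: level_credit_def bits flip: m_def)
    next
      case nless: False
      have "(F + k) mod m = F mod m + k - m"
      proof -
        have "(F + k) mod m = (F mod m + k) mod m" by (simp add: mod_add_left_eq)
        also have "\<dots> = F mod m + k - m"
        proof -
          have "F mod m + k - m < m" using lt False by linarith
          then show ?thesis using nless by (simp add: le_mod_geq)
        qed
        finally show ?thesis .
      qed
      \<comment> \<open>A wrap means \<open>F mod m + k >= m\<close>, which pays \<open>m\<close>
        even if the old or the new credit is truncated to 0.\<close>
      then have "level_credit i (F + k) + m \<le> level_credit i F + 2 * k"
        using nless lt False unfolding level_credit_def m_def [symmetric] by linarith
      then show ?thesis by (simp flip: m_def)
    qed
  qed
qed

text \<open>The residue keeps the bits below \<open>i\<close>, and a subset of the bits encodes a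
  number that is not larger. Emptying trees therefore never raises the credit, whichever bits it
  clears.\<close>

lemma mod_two_power_mono:
  fixes F G :: nat
  assumes "{i. bit G i} \<subseteq> {i. bit F i}"
  shows "G mod 2 ^ i \<le> F mod 2 ^ i"
proof -
  have "set_decode (take_bit i G) \<subseteq> set_decode (take_bit i F)"
    using assms by (auto simp: set_decode_eq bit_take_bit_iff)
  then have "take_bit i G \<le> take_bit i F" by (rule subset_decode_imp_le)
  then show ?thesis by (simp add: take_bit_eq_mod)
qed

text \<open>The factor \<open>i + 1\<close> is the logarithm in the construction cost at level
  \<open>i\<close>. The range includes the clear level \<open>floorlog 2 F\<close>, where
  \<open>F\<close> may already exceed half of \<open>2 ^ i\<close>.\<close>

definition credit :: "nat \<Rightarrow> nat" where
  "credit F = (\<Sum>i\<le>floorlog 2 F. (i + 1) * level_credit i F)"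

lemma level_credit_eq_0:
  assumes "floorlog 2 F < i"
  shows "level_credit i F = 0"
proof -
  have "2 * F < 2 * 2 ^ floorlog 2 F" using less_two_power_floorlog by simp
  also have "\<dots> \<le> 2 ^ i"
    using assms power_increasing [of "Suc (floorlog 2 F)" i "2::nat"] by simp
  finally show ?thesis by (simp add: level_credit_def)
qed

text \<open>A longer common range lets two counters of different length be compared level by
  level.\<close>

lemma credit_eq:
  assumes "floorlog 2 F \<le> N"
  shows "credit F = (\<Sum>i\<le>N. (i + 1) * level_credit i F)"
  unfolding credit_def using assms
  by (intro sum.mono_neutral_left) (auto simp: level_credit_eq_0)

lemma credit_mono_bits:
  assumes "{i. bit G i} \<subseteq> {i. bit F i}"
  shows "credit G \<le> credit F"
proof -
  have "G \<le> F"
    using assms subset_decode_imp_le [of G F] by (simp add: set_decode_eq)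
  then have "floorlog 2 G \<le> floorlog 2 F" by (rule floorlog_mono)
  moreover have "level_credit i G \<le> level_credit i F" for i
    using mod_two_power_mono [OF assms, of i] by (simp add: level_credit_def)
  ultimately show ?thesis
    by (simp only: credit_eq [of G "floorlog 2 F"] credit_def [of F])
      (intro sum_mono mult_left_mono, auto)
qed

text \<open>Each of the \<open>floorlog 2 (F + k) + 1\<close> levels asks for \<open>2 * k\<close>
  units of size at most that same number: this is the squared logarithm of an insertion.\<close>

lemma credit_add:
  "credit (F + k) + (\<Sum>i\<in>set (new_slots F (F + k)). 2 ^ i * (i + 1))
     \<le> credit F + 2 * k * (floorlog 2 (F + k) + 1)\<^sup>2"
proof -
  define N where "N = floorlog 2 (F + k)"
  define new where "new = {i. bit (F + k) i \<and> \<not> bit F i}"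
  have new: "new \<subseteq> {..N}"
    using floorlog2_gt_bit [of "F + k"] by (auto simp: new_def N_def intro: less_imp_le)
  have "(\<Sum>i\<in>new. 2 ^ i * (i + 1)) = (\<Sum>i\<le>N. (i + 1) * (if i \<in> new then 2 ^ i else 0))"
    using new by (intro sum.mono_neutral_cong_left) auto
  then have "credit (F + k) + (\<Sum>i\<in>new. 2 ^ i * (i + 1))
      = (\<Sum>i\<le>N. (i + 1) * (level_credit i (F + k) + (if i \<in> new then 2 ^ i else 0)))"
    by (simp only: credit_def N_def [symmetric] distrib_left sum.distrib)
  also have "\<dots> \<le> (\<Sum>i\<le>N. (i + 1) * (level_credit i F + 2 * k))"
    unfolding new_def using level_credit_add by (intro sum_mono mult_left_mono) auto
  also have "\<dots> = credit F + (\<Sum>i\<le>N. (i + 1) * (2 * k))"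
    using credit_eq [of F N] floorlog_mono [of F "F + k" 2]
    by (simp only: distrib_left sum.distrib N_def le_add1)
  also have "(\<Sum>i\<le>N. (i + 1) * (2 * k)) \<le> (\<Sum>i\<le>N. (N + 1) * (2 * k))"
    by (intro sum_mono mult_right_mono) auto
  also have "\<dots> = 2 * k * (N + 1)\<^sup>2"
    by (simp add: power2_eq_square algebra_simps)
  finally show ?thesis
    by (simp add: set_new_slots new_def N_def)
qed

section \<open>Distribution of old trees and new points over the rebuilt trees\<close>

lemma merged_into_lt: "j \<in> set (merged_into F F' i) \<Longrightarrow> j < i"
  by (simp add: merged_into_def)

lemma merged_into_disjoint:
  assumes "i \<in> set (new_slots F F')" "i' \<in> set (new_slots F F')" "i \<noteq> i'"
  shows "set (merged_into F F' i) \<inter> set (merged_into F F' i') = {}"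
  using assms by (fastforce simp: merged_into_def)

text \<open>If no bit above \<open>j\<close> were new, \<open>F'\<close> would have above
  \<open>j\<close> only bits of \<open>F\<close>, while its bits below \<open>j\<close> sum to less
  than the \<open>2 ^ j\<close> that \<open>F\<close> has and \<open>F'\<close> lacks. Then
  \<open>F' < F\<close>.\<close>

lemma new_slot_above_old_slot:
  assumes "F \<le> F'" "j \<in> set (old_slots F F')"
  shows "\<exists>i\<in>set (new_slots F F'). j < i"
proof (rule ccontr)
  assume "\<not> ?thesis"
  then have sub: "bit F i" if "bit F' i" "j < i" for i
    using that by (auto simp: set_new_slots)
  have j: "bit F j" "\<not> bit F' j" using assms(2) by (auto simp: set_old_slots)
  let ?H = "{i. bit F' i \<and> j < i}" and ?L = "{i. bit F' i \<and> i < j}"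
  have eq: "{i. bit F' i} = ?H \<union> ?L"
    using j by auto (metis linorder_neqE_nat)
  have "(\<Sum>i | bit F' i. 2 ^ i) = (\<Sum>i\<in>?H. 2 ^ i) + (\<Sum>i\<in>?L. 2 ^ i :: nat)"
    by (subst eq, rule sum.union_disjoint) auto
  then have "F' = (\<Sum>i\<in>?H. 2 ^ i) + (\<Sum>i\<in>?L. 2 ^ i)"
    by (simp add: sum_bits)
  also have "(\<Sum>i\<in>?L. 2 ^ i) < (2::nat) ^ j"
    by (rule sum_two_power_less) auto
  also have "(\<Sum>i\<in>?H. 2 ^ i) + (2::nat) ^ j = (\<Sum>i\<in>insert j ?H. 2 ^ i)"
    by simp
  also have "\<dots> \<le> (\<Sum>i | bit F i. 2 ^ i)"
    using j sub by (intro sum_mono2) auto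
  also have "\<dots> = F" by (rule sum_bits)
  finally show False using assms(1) by simp
qed

text \<open>The target of an old slot is the least new slot above it. Together with
  \<open>merged_into_disjoint\<close> this partitions the old slots, so sums over them can be
  regrouped by target.\<close>

lemma Union_merged_into:
  assumes "F \<le> F'"
  shows "(\<Union>i\<in>set (new_slots F F'). set (merged_into F F' i)) = set (old_slots F F')"
proof (intro equalityI subsetI)
  fix j assume j: "j \<in> set (old_slots F F')"
  define i where "i = (LEAST i. i \<in> set (new_slots F F') \<and> j < i)"
  have i: "i \<in> set (new_slots F F') \<and> j < i"
    unfolding i_def using new_slot_above_old_slot [OF assms j] by (metis (mono_tags, lifting) LeastI)
  moreover have "i \<le> i'" if "i' \<in> set (new_slots F F')" "j < i'" for i'
    unfolding i_def using that by (intro Least_le) auto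
  ultimately show "j \<in> (\<Union>i\<in>set (new_slots F F'). set (merged_into F F' i))"
    using j by (auto simp: merged_into_def)
qed (auto simp: merged_into_def)

lemma sum_merged_into:
  assumes "F \<le> F'"
  shows "(\<Sum>i\<in>set (new_slots F F'). \<Sum>j\<in>set (merged_into F F' i). f j) =
    (\<Sum>j\<in>set (old_slots F F'). f j :: 'a :: comm_monoid_add)"
  unfolding Union_merged_into [OF assms, symmetric]
  by (rule sum.UNION_disjoint [symmetric]) (use merged_into_disjoint in auto)

text \<open>The truncated subtraction in \<open>required\<close> is exact, because distinct powers
  of two below \<open>2 ^ i\<close> sum to less than \<open>2 ^ i\<close>.\<close>

lemma required_add:
  "required X F F' i + (\<Sum>j\<in>set (merged_into F F' i). 2 ^ j * X) = 2 ^ i * X"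
proof -
  have s: "(\<Sum>j\<leftarrow>merged_into F F' i. 2 ^ j) = (\<Sum>j\<in>set (merged_into F F' i). (2::nat) ^ j)"
    by (simp add: sum_list_distinct_conv_sum_set)
  have "(\<Sum>j\<in>set (merged_into F F' i). (2::nat) ^ j) < 2 ^ i"
    by (intro sum_two_power_less) (rule merged_into_lt)
  then show ?thesis
    unfolding required_def s sum_distrib_right [symmetric]
    by (metis add_mult_distrib le_add_diff_inverse2 less_imp_le)
qed

text \<open>Every rebuilt tree receives a new point, so the builder is never called with an empty
  list.\<close>

lemma required_pos:
  assumes "0 < X"
  shows "0 < required X F F' i"
proof -
  have "(\<Sum>j\<in>set (merged_into F F' i). (2::nat) ^ j) < 2 ^ i"
    by (intro sum_two_power_less) (rule merged_into_lt)
  then show ?thesis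
    using assms by (simp add: required_def sum_list_distinct_conv_sum_set)
qed

text \<open>The bits common to \<open>F\<close> and \<open>F + k\<close> cancel, so the capacities
  of the new slots exceed those of the old slots by \<open>k * X\<close>; the new points fill this
  excess.\<close>

lemma sum_required:
  "(\<Sum>i\<in>set (new_slots F (F + k)). required X F (F + k) i) = k * X"
proof -
  let ?new = "set (new_slots F (F + k))" and ?old = "set (old_slots F (F + k))"
  let ?both = "{i. bit F i \<and> bit (F + k) i}"
  have split: "m = (\<Sum>i | bit m i \<and> Q i. 2 ^ i) + (\<Sum>i | bit m i \<and> \<not> Q i. 2 ^ i)"
    for m :: nat and Q
  proof -
    have eq: "{i. bit m i} = {i. bit m i \<and> Q i} \<union> {i. bit m i \<and> \<not> Q i}" by auto
    have "(\<Sum>i | bit m i. 2 ^ i) =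
        (\<Sum>i | bit m i \<and> Q i. 2 ^ i) + (\<Sum>i | bit m i \<and> \<not> Q i. 2 ^ i :: nat)"
      by (subst eq, rule sum.union_disjoint) auto
    then show ?thesis by (simp add: sum_bits)
  qed
  have F: "F = (\<Sum>i\<in>?both. 2 ^ i) + (\<Sum>i\<in>?old. 2 ^ i)"
    using split [of F "bit (F + k)"] by (simp add: set_old_slots)
  have F': "F + k = (\<Sum>i\<in>?both. 2 ^ i) + (\<Sum>i\<in>?new. 2 ^ i)"
    using split [of "F + k" "bit F"] by (simp add: set_new_slots conj_commute)
  have "(\<Sum>i\<in>?new. required X F (F + k) i) + (\<Sum>j\<in>?old. 2 ^ j * X) = (\<Sum>i\<in>?new. 2 ^ i * X)"
    by (simp only: sum_merged_into [OF le_add1, symmetric] sum.distrib [symmetric] required_add)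
  then have "(\<Sum>i\<in>?new. required X F (F + k) i) + (\<Sum>j\<in>?old. 2 ^ j) * X = (\<Sum>i\<in>?new. 2 ^ i) * X"
    by (simp add: sum_distrib_right)
  moreover have "(\<Sum>j\<in>?old. 2 ^ j) + k = (\<Sum>i\<in>?new. 2 ^ i)"
    using F F' by linarith
  ultimately show ?thesis
    by (metis add.commute add_left_cancel add_mult_distrib)
qed

definition offset :: "nat \<Rightarrow> nat \<Rightarrow> nat \<Rightarrow> nat \<Rightarrow> nat" where
  "offset X F F' i = (\<Sum>i' | i' \<in> set (new_slots F F') \<and> i' < i. required X F F' i')"

lemma share_eq: "share X F F' P i = take (required X F F' i) (drop (offset X F F' i) P)"
proof -
  have "(\<Sum>i'\<leftarrow>filter (\<lambda>i'. i' < i) (new_slots F F'). required X F F' i') = offset X F F' i"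
    by (simp add: sum_list_distinct_conv_sum_set offset_def)
  then show ?thesis by (simp only: share_def)
qed

lemma offset_step:
  assumes "i \<in> set (new_slots F F')" "i < i'"
  shows "offset X F F' i + required X F F' i \<le> offset X F F' i'"
proof -
  have "offset X F F' i + required X F F' i =
      (\<Sum>i'\<in>insert i {i'. i' \<in> set (new_slots F F') \<and> i' < i}. required X F F' i')"
    by (simp add: offset_def)
  also have "\<dots> \<le> offset X F F' i'"
    unfolding offset_def using assms by (intro sum_mono2) auto
  finally show ?thesis .
qed

text \<open>All segments together are exactly as long as \<open>P\<close>, so \<open>take\<close>
  never runs short.\<close>

lemma length_share:
  assumes "i \<in> set (new_slots F (F + k))" "length P = k * X"
  shows "length (share X F (F + k) P i) = required X F (F + k) i"
proof -
  have "offset X F (F + k) i + required X F (F + k) i =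
      (\<Sum>i'\<in>insert i {i'. i' \<in> set (new_slots F (F + k)) \<and> i' < i}. required X F (F + k) i')"
    by (simp add: offset_def)
  also have "\<dots> \<le> (\<Sum>i'\<in>set (new_slots F (F + k)). required X F (F + k) i')"
    using assms by (intro sum_mono2) auto
  also have "\<dots> = k * X" by (rule sum_required)
  finally show ?thesis using assms(2) by (simp add: share_eq)
qed

lemma set_share_subset: "set (share X F F' P i) \<subseteq> set P"
  unfolding share_def by (meson order_trans set_drop_subset set_take_subset)

lemma share_disjoint:
  assumes "distinct P" "i \<in> set (new_slots F F')" "i' \<in> set (new_slots F F')" "i \<noteq> i'"
  shows "set (share X F F' P i) \<inter> set (share X F F' P i') = {}"
proof -
  have *: "set (share X F F' P i) \<inter> set (share X F F' P i') = {}"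
    if "i < i'" "i \<in> set (new_slots F F')" for i i'
  proof -
    \<comment> \<open>Cutting \<open>P\<close> at the end of the segment of \<open>i\<close>
      separates the two shares.\<close>
    let ?m = "offset X F F' i + required X F F' i"
    have "set (share X F F' P i) \<subseteq> set (take ?m P)"
      by (simp add: share_eq take_drop set_drop_subset add.commute)
    moreover have "set (share X F F' P i') \<subseteq> set (drop ?m P)"
      using offset_step [OF that(2,1), of X]
      by (metis share_eq order_trans set_drop_subset_set_drop set_take_subset)
    moreover have "set (take ?m P) \<inter> set (drop ?m P) = {}"
      using assms(1) by (simp add: set_take_disj_set_drop_if_distinct)
    ultimately show ?thesis by blast
  qed
  show ?thesis using * [of i i'] * [of i' i] assms(2-4) by (metis Int_commute linorder_neqE_nat)
qed

section \<open>Batch insertion\<close>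

definition tree_list :: "'d bdl \<Rightarrow> nat \<Rightarrow> 'd pt list" where
  "tree_list s i = points_opt (map_option fst (slot s i))"

lemma val_gather_opt [simp]: "val (gather_opt to) = points_opt to"
  by (cases to) (simp_all add: gather_opt_def)

lemma bit_flags:
  assumes "finite (dom (slot s))"
  shows "bit (flags s) i \<longleftrightarrow> slot s i \<noteq> None"
proof -
  have "{i. slot s i \<noteq> None} = dom (slot s)" by auto
  then show ?thesis
    using bit_sum_iff [OF assms, of i] by (auto simp: flags_def)
qed

definition deficit :: "nat \<Rightarrow> 'd bdl \<Rightarrow> nat" where
  "deficit X s = (\<Sum>i | bit (flags s) i. 2 ^ i * X - length (tree_list s i))"

text \<open>The asymptotic construction bounds in explicit form, by level instead of number of
  points; \<open>X\<close> is absorbed into the constants. Writing \<open>i + 1\<close> keeps both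
  bounds positive at level 0, which also serves the buffer tree. Suitable \<open>KW\<close> and
  \<open>KD\<close> come from \<open>kd_construction_exists\<close>.\<close>

locale kd_construction =
  fixes build :: "'d::{finite,linorder} builder" and X b KW KD :: nat
  assumes X_pos: "0 < X" and b_pos: "0 < b"
    and builder: "kd_builder b build"
    and work_build: "\<And>ps i. \<lbrakk>ps \<noteq> []; distinct ps; length ps \<le> 2 ^ i * X\<rbrakk>
      \<Longrightarrow> work (build ps) \<le> KW * (2 ^ i * (i + 1))"
    and depth_build: "\<And>ps i. \<lbrakk>ps \<noteq> []; distinct ps; length ps \<le> 2 ^ i * X\<rbrakk>
      \<Longrightarrow> depth (build ps) \<le> KD * ((i + 1) * floorlog 2 (i + 1))"
begin

lemma mset_build: "ps \<noteq> [] \<Longrightarrow> distinct ps \<Longrightarrow> mset (points (val (build ps))) = mset ps"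
  using builder by (simp add: kd_builder_def)

lemma build_points:
  assumes "ps \<noteq> []" "distinct ps"
  shows "set (points (val (build ps))) = set ps" "length (points (val (build ps))) = length ps"
  using mset_build [OF assms] by (auto dest: mset_eq_setD mset_eq_length)

lemma sound_build:
  assumes "ps \<noteq> []" "distinct ps" "length ps \<le> 2 ^ i * X"
  shows "sound b (i + X + 1) (val (build ps))"
proof -
  \<comment> \<open>\<open>X <= 2 ^ X\<close> trades the constant capacity for \<open>X\<close>
    extra levels.\<close>
  have "length ps \<le> 2 ^ i * 2 ^ X"
    using assms(3) less_exp [of X] by (meson less_imp_le mult_le_mono2 order_trans)
  then show ?thesis
    using kd_builder_sound [OF builder b_pos assms(1,2), of "i + X"] by (simp add: power_add)
qed

definition valid_buffer :: "('d pt, 'd) kdtree option \<Rightarrow> bool" where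
  "valid_buffer to \<longleftrightarrow> pred_option (sound b (X + 1)) to \<and> length (points_opt to) < X"

lemma valid_buffer_distinct: "valid_buffer to \<Longrightarrow> distinct (points_opt to)"
  by (cases to) (auto simp: valid_buffer_def sound_def)

lemma build_opt_bounds:
  assumes "distinct Q" "length Q < X"
  shows "valid_buffer (val (build_opt build Q))"
    and "set (points_opt (val (build_opt build Q))) = set Q"
    and "work (build_opt build Q) \<le> KW"
    and "depth (build_opt build Q) \<le> KD"
proof -
  have len: "length Q \<le> 2 ^ 0 * X" using assms by simp
  have "floorlog 2 1 = 1" by (simp add: floorlog_def)
  then show "valid_buffer (val (build_opt build Q))"
    and "set (points_opt (val (build_opt build Q))) = set Q"
    and "work (build_opt build Q) \<le> KW"
    and "depth (build_opt build Q) \<le> KD"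
    using sound_build [OF _ assms(1) len] work_build [OF _ assms(1) len]
      depth_build [OF _ assms(1) len] X_pos build_points [OF _ assms(1)] assms
    by (auto simp: build_opt_def valid_buffer_def)
qed

text \<open>The old buffer and the remainder together have fewer than \<open>2 * X\<close> points,
  so gathering and rebuilding the buffer cost a constant; only the branch of a full buffer copies
  the batch. That branch also passes on one block beyond \<open>length P div X\<close>, whence the
  \<open>+ 1\<close>.\<close>

lemma fill_buffer_bounds:
  fixes s :: "'d bdl"
  assumes buf: "valid_buffer (buffer s)" and P: "distinct P"
    and disj: "set P \<inter> set (points_opt (buffer s)) = {}"
  defines "r \<equiv> val (fill_buffer build X P s)"
  shows "valid_buffer (fst r)" and "distinct (snd r)"
    and "set (points_opt (fst r)) \<union> set (snd r) \<subseteq> set (points_opt (buffer s)) \<union> set P"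
    and "set (points_opt (fst r)) \<inter> set (snd r) = {}"
    and "X dvd length (snd r)"
    and "length (snd r) \<le> length P + X"
    and "length (snd r) div X \<le> length P div X + 1"
    and "P = [] \<Longrightarrow> snd r = []"
    and "work (fill_buffer build X P s) \<le> length P + (7 + 7 * X + KW)"
    and "depth (fill_buffer build X P s) \<le> floorlog 2 (length P) + (9 + 5 * X + b + KD)"
proof -
  let ?fill = "fill_buffer build X P s"
  let ?post = "valid_buffer (fst r) \<and> distinct (snd r) \<and>
    set (points_opt (fst r)) \<union> set (snd r) \<subseteq> set (points_opt (buffer s)) \<union> set P \<and>
    set (points_opt (fst r)) \<inter> set (snd r) = {} \<and> X dvd length (snd r) \<and>
    length (snd r) \<le> length P + X \<and>
    length (snd r) div X \<le> length P div X + 1 \<and> (P = [] \<longrightarrow> snd r = []) \<and>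
    work ?fill \<le> length P + (7 + 7 * X + KW) \<and>
    depth ?fill \<le> floorlog 2 (length P) + (9 + 5 * X + b + KD)"
  define m where "m = length P mod X"
  have ?post
  proof (cases "m = 0")
    case True
    then have "r = (buffer s, P)" "work ?fill = 1" "depth ?fill = 1"
      unfolding r_def m_def by (simp_all add: fill_buffer_def)
    then show ?thesis
      using assms True by (auto simp: m_def dvd_eq_mod_eq_0)
  next
    case False
    define old where "old = points_opt (buffer s)"
    define Q where "Q = old @ take m P"
    have mX: "m < X" "m \<le> length P" using X_pos by (auto simp: m_def)
    have Pm: "length P - m = length P div X * X"
      by (simp add: m_def minus_mod_eq_div_mult)
    have old: "distinct old" "length old < X" "set P \<inter> set old = {}"
      using buf disj valid_buffer_distinct by (auto simp: old_def valid_buffer_def)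
    have tP: "set (take m P) \<inter> set (drop m P) = {}"
      using P by (simp add: set_take_disj_set_drop_if_distinct)
    have sP: "set (take m P) \<subseteq> set P" "set (drop m P) \<subseteq> set P"
      by (simp_all add: set_take_subset set_drop_subset)
    have Q: "distinct Q" "length Q < 2 * X" "set Q \<subseteq> set old \<union> set P"
      "set Q \<inter> set (drop m P) = {}"
      using old P sP mX tP by (auto simp: Q_def)
    have tQ: "set (take X Q) \<inter> set (drop X Q) = {}"
      using Q by (simp add: set_take_disj_set_drop_if_distinct)
    have sQ: "set (take X Q) \<subseteq> set Q" "set (drop X Q) \<subseteq> set Q"
      by (simp_all add: set_take_subset set_drop_subset)
    have Pne: "P \<noteq> []" using False by (auto simp: m_def)
    have go: "work (gather_opt (buffer s)) \<le> 4 * X" "depth (gather_opt (buffer s)) \<le> 2 * (X + 1) + b"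
      using gather_opt_bounds [of b "X + 1" "buffer s"] buf old(2)
      by (auto simp: valid_buffer_def old_def)
    have pq: "val (pconcat [old, take m P]) = Q" "work (pconcat [old, take m P]) \<le> 3 + 2 * X"
      "depth (pconcat [old, take m P]) \<le> 3 + 2 * X"
      using Q(2) floorlog2_le [of "2 + length Q"] by (auto simp: Q_def)
    have fill: "?fill = tick 1 \<bind> (\<lambda>_. gather_opt (buffer s) \<bind> (\<lambda>old.
        pconcat [old, take m P] \<bind> (\<lambda>Q. if length Q < X then
          build_opt build Q \<bind> (\<lambda>buf. ret (buf, drop m P)) else
          build_opt build (drop X Q) \<bind> (\<lambda>buf. pconcat [drop m P, take X Q] \<bind> (\<lambda>P'. ret (buf, P'))))))"
      using False by (simp add: fill_buffer_def Let_def m_def [symmetric] del: neq0_conv)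
    show ?thesis
    proof (cases "length Q < X")
      case True
      note bo = build_opt_bounds [OF Q(1) True]
      have r: "r = (val (build_opt build Q), drop m P)"
        unfolding r_def fill using pq(1) True by (simp add: old_def del: comp_pconcat)
      have w: "work ?fill = 1 + work (gather_opt (buffer s)) + work (pconcat [old, take m P])
          + work (build_opt build Q)"
        unfolding fill using pq(1) True by (simp add: old_def del: comp_pconcat)
      have d: "depth ?fill = 1 + depth (gather_opt (buffer s)) + depth (pconcat [old, take m P])
          + depth (build_opt build Q)"
        unfolding fill using pq(1) True by (simp add: old_def del: comp_pconcat)
      have "work ?fill \<le> length P + (7 + 7 * X + KW)"
        "depth ?fill \<le> floorlog 2 (length P) + (9 + 5 * X + b + KD)"
        unfolding w d using go pq(2,3) bo(3,4) by (linarith, simp)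
      then show ?thesis
        unfolding r using bo Q(3,4) P sP Pm X_pos Pne by (auto simp: old_def)
    next
      case nless: False
      have dQ: "distinct (drop X Q)" "length (drop X Q) < X" using Q(1,2) by auto
      note bo = build_opt_bounds [OF dQ]
      have r: "r = (val (build_opt build (drop X Q)), drop m P @ take X Q)"
        unfolding r_def fill using pq(1) nless by (simp add: old_def)
      have w: "work ?fill = 1 + work (gather_opt (buffer s)) + work (pconcat [old, take m P])
          + work (build_opt build (drop X Q)) + work (pconcat [drop m P, take X Q])"
        unfolding fill using pq(1) nless by (simp add: old_def del: comp_pconcat)
      have d: "depth ?fill = 1 + depth (gather_opt (buffer s)) + depth (pconcat [old, take m P])
          + depth (build_opt build (drop X Q)) + depth (pconcat [drop m P, take X Q])"
        unfolding fill using pq(1) nless by (simp add: old_def del: comp_pconcat)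
      \<comment> \<open>The \<open>m\<close> leftover points are exchanged for a full block of
        \<open>X\<close> points.\<close>
      have len: "length (drop m P @ take X Q) = (length P div X + 1) * X"
        using nless Pm by simp
      have "length (drop m P @ take X Q) \<le> length P + X"
        using nless by simp
      then have "work (pconcat [drop m P, take X Q]) \<le> 3 + length P + X"
        "depth (pconcat [drop m P, take X Q]) \<le> 1 + floorlog 2 (length P + (2 + X))"
        by (auto intro: floorlog_mono)
      then have "work ?fill \<le> length P + (7 + 7 * X + KW)"
        "depth ?fill \<le> floorlog 2 (length P) + (9 + 5 * X + b + KD)"
        unfolding w d using go pq(2,3) bo(3,4) floorlog2_add_le [of "length P" "2 + X"] by (linarith, simp)
      moreover have "distinct (drop m P @ take X Q)" using Q(1,4) P sQ by auto
      moreover have "set (drop X Q) \<union> set (drop m P @ take X Q) \<subseteq> set old \<union> set P"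
        using Q(3) sP sQ by auto
      moreover have "set (drop X Q) \<inter> set (drop m P @ take X Q) = {}"
        using Q(4) sQ tQ by auto
      moreover have "length (drop m P @ take X Q) div X = length P div X + 1"
        unfolding len using X_pos by simp
      moreover have "X dvd length (drop m P @ take X Q)"
        unfolding len by simp
      ultimately show ?thesis
        unfolding r using bo(1,2) Pne \<open>length (drop m P @ take X Q) \<le> length P + X\<close>
        by (simp only: fst_conv snd_conv old_def simp_thms)
    qed
  qed
  then show "valid_buffer (fst r)" and "distinct (snd r)"
    and "set (points_opt (fst r)) \<union> set (snd r) \<subseteq> set (points_opt (buffer s)) \<union> set P"
    and "set (points_opt (fst r)) \<inter> set (snd r) = {}"
    and "X dvd length (snd r)"
    and "length (snd r) \<le> length P + X"
    and "length (snd r) div X \<le> length P div X + 1"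
    and "P = [] \<Longrightarrow> snd r = []"
    and "work (fill_buffer build X P s) \<le> length P + (7 + 7 * X + KW)"
    and "depth (fill_buffer build X P s) \<le> floorlog 2 (length P) + (9 + 5 * X + b + KD)"
    by blast+
qed

text \<open>Disjointness of the trees lets sizes and removals be added over them. The height bound
  is the one after construction at level \<open>i\<close>. Exactly half full is allowed, matching
  the strict test in \<open>batch_delete\<close>.\<close>

definition valid :: "'d bdl \<Rightarrow> bool" where
  "valid s \<longleftrightarrow> finite (dom (slot s)) \<and> valid_buffer (buffer s) \<and>
     (\<forall>i t c. slot s i = Some (t, c) \<longrightarrow>
        sound b (i + X + 1) t \<and> c = length (points t) \<and> 2 ^ i * X \<le> 2 * c \<and> c \<le> 2 ^ i * X) \<and>
     (\<forall>i j. i \<noteq> j \<longrightarrow> set (tree_list s i) \<inter> set (tree_list s j) = {}) \<and>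
     (\<forall>i. set (points_opt (buffer s)) \<inter> set (tree_list s i) = {})"

lemma valid_sound: "valid s \<Longrightarrow> pred_option (sound b (i + X + 1)) (map_option fst (slot s i))"
  by (cases "slot s i") (auto simp: valid_def)

lemma valid_distinct: "valid s \<Longrightarrow> distinct (tree_list s i)"
  by (cases "slot s i") (fastforce simp: valid_def tree_list_def sound_def)+

lemma valid_bit: "valid s \<Longrightarrow> bit (flags s) i \<longleftrightarrow> slot s i \<noteq> None"
  by (intro bit_flags) (simp add: valid_def)

lemma valid_length:
  assumes "valid s" "bit (flags s) i"
  shows "2 ^ i * X \<le> 2 * length (tree_list s i)" "length (tree_list s i) \<le> 2 ^ i * X"
  using assms valid_bit [OF assms(1), of i] by (fastforce simp: valid_def tree_list_def)+

lemma valid_tree_list_empty: "valid s \<Longrightarrow> \<not> bit (flags s) i \<Longrightarrow> tree_list s i = []"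
  using valid_bit [of s i] by (cases "slot s i") (simp_all add: tree_list_def)

lemma valid_gather:
  assumes "valid s"
  shows "work (gather_opt (map_option fst (slot s i))) \<le> 4 * length (tree_list s i)"
    and "depth (gather_opt (map_option fst (slot s i))) \<le> 2 * i + 2 * X + 2 + b"
  using gather_opt_bounds [OF valid_sound [OF assms]] by (simp_all add: tree_list_def)

lemma length_merged_into_le: "length (merged_into F F' i) \<le> i"
proof -
  have "length (merged_into F F' i) = card (set (merged_into F F' i))"
    by (simp add: distinct_card)
  also have "\<dots> \<le> card {..<i}"
    using merged_into_lt by (intro card_mono) auto
  finally show ?thesis by simp
qed

section \<open>Rebuilding one tree during an insertion\<close>

definition merged_points :: "'d bdl \<Rightarrow> nat \<Rightarrow> 'd pt list \<Rightarrow> nat \<Rightarrow> 'd pt list" where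
  "merged_points s F' P i =
     concat (map (tree_list s) (merged_into (flags s) F' i)) @ share X (flags s) F' P i"

text \<open>The loop body of \<open>batch_insert\<close>, named so that its cost can be bounded
  separately.\<close>

definition rebuild :: "'d bdl \<Rightarrow> nat \<Rightarrow> 'd pt list \<Rightarrow> nat \<Rightarrow> (nat \<times> ('d pt, 'd) kdtree \<times> nat) comp" where
  "rebuild s F' P i = do {
     olds \<leftarrow> pmap (\<lambda>j. gather_opt (map_option fst (slot s j))) (merged_into (flags s) F' i);
     Q \<leftarrow> pconcat (olds @ [share X (flags s) F' P i]);
     t \<leftarrow> build Q;
     ret (i, (t, length Q))
   }"

context
  fixes s :: "'d bdl" and P :: "'d pt list" and k :: nat
  assumes valid: "valid s" and distinct: "distinct P" and length_P: "length P = k * X"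
    and disjoint: "\<And>i. set P \<inter> set (tree_list s i) = {}"
begin

private abbreviation "F \<equiv> flags s"
private abbreviation "F' \<equiv> flags s + k"
private abbreviation "Q \<equiv> merged_points s F' P"

lemma trees_disjoint: "i \<noteq> j \<Longrightarrow> set (tree_list s i) \<inter> set (tree_list s j) = {}"
  using valid by (simp add: valid_def)

lemma distinct_merged_points: "distinct (Q i)"
proof -
  have "distinct (concat (map (tree_list s) js))" if "distinct js" for js
    using that
  proof (induction js)
    case (Cons j js)
    have "set (tree_list s j) \<inter> set (tree_list s j') = {}" if "j' \<in> set js" for j'
      using Cons.prems that by (intro trees_disjoint) auto
    then have "set (tree_list s j) \<inter> set (concat (map (tree_list s) js)) = {}"
      by auto
    then show ?case
      using Cons valid_distinct [OF valid] by simp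
  qed simp
  moreover have "distinct (share X F F' P i)"
    using distinct by (simp add: share_def)
  moreover have "set (concat (map (tree_list s) js)) \<inter> set (share X F F' P i) = {}" for js
  proof -
    have "set (concat (map (tree_list s) js)) \<inter> set P = {}"
      using disjoint by auto
    then show ?thesis using set_share_subset [of X F F' P i] by blast
  qed
  ultimately show ?thesis by (simp add: merged_points_def)
qed

lemma length_merged_points:
  assumes "i \<in> set (new_slots F F')"
  shows "length (Q i) = (\<Sum>j\<in>set (merged_into F F' i). length (tree_list s j)) + required X F F' i"
proof -
  have "length (concat (map (tree_list s) (merged_into F F' i)))
      = (\<Sum>j\<in>set (merged_into F F' i). length (tree_list s j))"
    by (simp add: length_concat comp_def sum_list_distinct_conv_sum_set)
  then show ?thesis
    using length_share [OF assms length_P] by (simp add: merged_points_def)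
qed

lemma merged_bit: "j \<in> set (merged_into F F' i) \<Longrightarrow> bit F j"
  by (simp add: merged_into_def set_old_slots)

text \<open>The merged trees and the required new points have together exactly the capacity of slot
  \<open>i\<close>, and the new points fill their part completely. So the deficit of the result is
  the sum of the deficits of the merged trees, and it is at least half full because they
  are.\<close>

lemma merged_points_capacity:
  assumes "i \<in> set (new_slots F F')"
  shows "2 ^ i * X - length (Q i) =
      (\<Sum>j\<in>set (merged_into F F' i). 2 ^ j * X - length (tree_list s j))"
    and "length (Q i) \<le> 2 ^ i * X" and "2 ^ i * X \<le> 2 * length (Q i)"
    and "Q i \<noteq> []"
proof -
  let ?J = "set (merged_into F F' i)"
  have le: "length (tree_list s j) \<le> 2 ^ j * X" "2 ^ j * X \<le> 2 * length (tree_list s j)"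
    if "j \<in> ?J" for j
    using valid_length [OF valid merged_bit [OF that]] by auto
  have 1: "(\<Sum>j\<in>?J. length (tree_list s j)) \<le> (\<Sum>j\<in>?J. 2 ^ j * X)"
    using le by (intro sum_mono) auto
  have 2: "(\<Sum>j\<in>?J. 2 ^ j * X) \<le> 2 * (\<Sum>j\<in>?J. length (tree_list s j))"
    unfolding sum_distrib_left using le by (intro sum_mono) auto
  have 3: "(\<Sum>j\<in>?J. 2 ^ j * X - length (tree_list s j)) =
      (\<Sum>j\<in>?J. 2 ^ j * X) - (\<Sum>j\<in>?J. length (tree_list s j))"
    using le by (intro sum_subtractf_nat) auto
  note 4 = length_merged_points [OF assms] required_add [of X F F' i]
    required_pos [OF X_pos, of F F' i]
  show "2 ^ i * X - length (Q i) = (\<Sum>j\<in>?J. 2 ^ j * X - length (tree_list s j))"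
    "length (Q i) \<le> 2 ^ i * X" "2 ^ i * X \<le> 2 * length (Q i)"
    using 1 2 3 4 by linarith+
  show "Q i \<noteq> []" using 4 by auto
qed

lemma val_rebuild: "val (rebuild s F' P i) = (i, val (build (Q i)), length (Q i))"
  by (simp add: rebuild_def merged_points_def flip: tree_list_def)

text \<open>\<open>2 ^ i * (i + 1)\<close> dominates 1, \<open>i\<close> and, up to the factor
  \<open>X\<close>, the number of points, so gathering and copying fit into the same term as
  building. The 1 on the left is the charge of the outer loop for one iteration.\<close>

lemma work_rebuild:
  assumes i: "i \<in> set (new_slots F F')"
  shows "1 + work (rebuild s F' P i) \<le> (6 + 5 * X + KW) * (2 ^ i * (i + 1))"
proof -
  let ?ms = "merged_into F F' i" and ?w = "2 ^ i * (i + 1) :: nat"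
  have w: "1 \<le> ?w" "i \<le> ?w" "2 ^ i \<le> ?w"
    by (simp_all add: Suc_le_eq trans_le_add2)
  have "(\<Sum>j\<leftarrow>?ms. 1 + work (gather_opt (map_option fst (slot s j))))
      \<le> (\<Sum>j\<leftarrow>?ms. 1 + 4 * length (tree_list s j))"
    using valid_gather [OF valid] by (intro sum_list_mono) simp
  also have "\<dots> = length ?ms + 4 * (\<Sum>j\<in>set ?ms. length (tree_list s j))"
    by (simp add: sum_list_distinct_conv_sum_set sum_Suc distinct_card sum_distrib_left)
  finally have "(\<Sum>j\<leftarrow>?ms. 1 + work (gather_opt (map_option fst (slot s j))))
      \<le> i + 4 * length (Q i)"
    using length_merged_into_le [of F F' i] length_merged_points [OF i] by linarith
  moreover have "work (pconcat (map (tree_list s) ?ms @ [share X F F' P i])) \<le> 2 + i + length (Q i)"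
    using length_merged_into_le [of F F' i] by (simp add: merged_points_def)
  moreover have "work (build (Q i)) \<le> KW * ?w"
    using merged_points_capacity [OF i] distinct_merged_points by (intro work_build) auto
  moreover have "work (rebuild s F' P i) =
      1 + (\<Sum>j\<leftarrow>?ms. 1 + work (gather_opt (map_option fst (slot s j))))
      + work (pconcat (map (tree_list s) ?ms @ [share X F F' P i])) + work (build (Q i))"
    by (simp add: rebuild_def merged_points_def flip: tree_list_def)
  ultimately have "1 + work (rebuild s F' P i) \<le> 4 + 2 * i + 5 * length (Q i) + KW * ?w"
    by linarith
  also have "5 * length (Q i) \<le> 5 * (X * ?w)"
    using merged_points_capacity(2) [OF i] mult_le_mono2 [OF w(3), of X]
    by (simp only: mult.commute [of X] mult_le_cancel1) linarith
  also have "4 + 2 * i + 5 * (X * ?w) + KW * ?w \<le> (6 + 5 * X + KW) * ?w"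
    using w by (simp only: distrib_right mult.assoc)
  finally show ?thesis by simp
qed

lemma depth_rebuild:
  assumes i: "i \<in> set (new_slots F F')"
  defines "L \<equiv> floorlog 2 F'"
  shows "depth (rebuild s F' P i) \<le> 5 * L + 3 * X + b + 9 + KD * (L * floorlog 2 L)"
proof -
  let ?ms = "merged_into F F' i"
  have L: "i + 1 \<le> L"
    using i floorlog2_gt_bit [of F' i] by (simp add: L_def set_new_slots)
  have m: "length ?ms \<le> i" by (rule length_merged_into_le)
  have "depth (gather_opt (map_option fst (slot s j))) \<le> 2 * i + 2 * X + 2 + b"
    if "j \<in> set ?ms" for j
    using valid_gather(2) [OF valid, of j] merged_into_lt [OF that] by simp
  then have "depth (pmap (\<lambda>j. gather_opt (map_option fst (slot s j))) ?ms)
      \<le> 1 + floorlog 2 (length ?ms) + (2 * i + 2 * X + 2 + b)"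
    by (rule depth_pmap_le)
  then have g: "depth (pmap (\<lambda>j. gather_opt (map_option fst (slot s j))) ?ms)
      \<le> 1 + i + 2 * i + 2 * X + 2 + b"
    using floorlog2_le [of "length ?ms"] m by linarith
  have "length (Q i) < 2 ^ (i + X)"
    using merged_points_capacity(2) [OF i] less_exp [of X]
    by (metis mult_less_mono2 order_le_less_trans power_add zero_less_numeral zero_less_power)
  then have "floorlog 2 (length (Q i)) \<le> i + X"
    by (intro floorlog_leI) auto
  then have c: "depth (pconcat (map (tree_list s) ?ms @ [share X F F' P i])) \<le> 3 + 2 * i + X"
    using floorlog2_add_le [of "length (Q i)" "Suc (length ?ms)"] m
    by (simp add: merged_points_def add_ac)
  have "depth (build (Q i)) \<le> KD * ((i + 1) * floorlog 2 (i + 1))"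
    using merged_points_capacity [OF i] distinct_merged_points by (intro depth_build) auto
  also have "\<dots> \<le> KD * (L * floorlog 2 L)"
    using L by (intro mult_le_mono floorlog_mono) auto
  finally have d: "depth (build (Q i)) \<le> KD * (L * floorlog 2 L)" .
  have "depth (rebuild s F' P i) = depth (pmap (\<lambda>j. gather_opt (map_option fst (slot s j))) ?ms)
      + depth (pconcat (map (tree_list s) ?ms @ [share X F F' P i])) + depth (build (Q i))"
    by (simp add: rebuild_def merged_points_def flip: tree_list_def)
  then show ?thesis using g c d L by linarith
qed

end

lemma batch_insert_eq:
  "batch_insert build X P s = do {
     (buf, P') \<leftarrow> fill_buffer build X P s;
     let F' = flags s + length P' div X;
     tick (1 + floorlog 2 F');
     built \<leftarrow> pmap (rebuild s F' P') (new_slots (flags s) F');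
     ret \<lparr>buffer = buf,
          slot = (\<lambda>i. if i \<in> set (old_slots (flags s) F') then None
                      else if i \<in> set (new_slots (flags s) F') then map_of built i
                      else slot s i)\<rparr>
   }"
  unfolding batch_insert_def rebuild_def Let_def ..

text \<open>\<open>k\<close> is the number of blocks of \<open>X\<close> points that leave the
  buffer stage; it depends on the filling of the buffer. An empty batch, which a deletion inserts
  when all trees stay at least half full, must give \<open>k = 0\<close>. The credit stands on both
  sides to avoid truncated subtraction.\<close>

lemma batch_insert_bounds:
  assumes valid: "valid s" and P: "distinct P"
    and disj_buf: "set P \<inter> set (points_opt (buffer s)) = {}"
    and disj: "\<And>i. set P \<inter> set (tree_list s i) = {}"
  defines "s' \<equiv> val (batch_insert build X P s)"
  shows "\<exists>k. valid s' \<and> flags s' = flags s + k \<and> deficit X s' = deficit X s \<and>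
    k \<le> length P div X + 1 \<and> (P = [] \<longrightarrow> k = 0) \<and>
    work (batch_insert build X P s) + (6 + 5 * X + KW) * credit (flags s')
      \<le> length P + (6 + 5 * X + KW) * (credit (flags s) + 2 * k * (floorlog 2 (flags s') + 1)\<^sup>2)
        + floorlog 2 (flags s') + (9 + 7 * X + KW) \<and>
    depth (batch_insert build X P s)
      \<le> floorlog 2 (length P) + 7 * floorlog 2 (flags s')
        + KD * (floorlog 2 (flags s') * floorlog 2 (floorlog 2 (flags s')))
        + (20 + 8 * X + 2 * b + KD)"
proof -
  let ?K = "6 + 5 * X + KW"
  define buf where "buf = fst (val (fill_buffer build X P s))"
  define P' where "P' = snd (val (fill_buffer build X P s))"
  define k where "k = length P' div X"
  define F where "F = flags s"
  define F' where "F' = F + k"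
  define Q where "Q = merged_points s F' P'"
  define L where "L = floorlog 2 F'"
  let ?new = "set (new_slots F F')" and ?old = "set (old_slots F F')"
  have vbuf: "valid_buffer (buffer s)" using valid by (simp add: valid_def)
  note fb = fill_buffer_bounds [OF vbuf P disj_buf, folded buf_def P'_def]
  have length_P': "length P' = k * X" using fb(5) by (simp add: k_def)
  have buf_trees: "set (points_opt (buffer s)) \<inter> set (tree_list s i) = {}" for i
    using valid by (simp add: valid_def)
  have disj_P': "set P' \<inter> set (tree_list s i) = {}" for i
    using fb(3) disj [of i] buf_trees [of i] by blast
  have disj_buf': "set (points_opt buf) \<inter> set (tree_list s i) = {}" for i
    using fb(3) disj [of i] buf_trees [of i] by blast
  note ctx = valid fb(2) length_P' disj_P'
  note distinct_Q = distinct_merged_points [OF ctx, folded F_def, folded F'_def, folded Q_def]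
  note capacity = merged_points_capacity [OF ctx, folded F_def, folded F'_def, folded Q_def]
  note val_re = val_rebuild [OF ctx, folded F_def, folded F'_def, folded Q_def]
  note work_re = work_rebuild [OF ctx, folded F_def, folded F'_def, folded Q_def]
  note depth_re = depth_rebuild [OF ctx, folded F_def, folded F'_def, folded Q_def L_def]
  have s': "s' = \<lparr>buffer = buf, slot = (\<lambda>i. if i \<in> ?old then None
      else if i \<in> ?new then Some (val (build (Q i)), length (Q i)) else slot s i)\<rparr>"
    unfolding s'_def batch_insert_eq
    by (auto simp: case_prod_beta Let_def val_re map_of_map_restrict restrict_map_def comp_def
        fun_eq_iff simp flip: buf_def P'_def k_def F_def F'_def)
  have slot_s: "bit F i \<longleftrightarrow> slot s i \<noteq> None" for i
    unfolding F_def by (rule valid_bit [OF valid])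
  have slot_s': "slot s' i \<noteq> None \<longleftrightarrow> bit F' i" for i
    using slot_s [of i] by (auto simp: s' set_old_slots set_new_slots)
  then have dom_s': "dom (slot s') = {i. bit F' i}" by auto
  have flags_s': "flags s' = F'"
    unfolding flags_def using slot_s' by (simp add: sum_bits)
  have tree_s': "set (tree_list s' i) = (if i \<in> ?old then {} else if i \<in> ?new then set (Q i)
      else set (tree_list s i))"
    "length (tree_list s' i) = (if i \<in> ?old then 0 else if i \<in> ?new then length (Q i)
      else length (tree_list s i))" for i
    using build_points [OF capacity(4) distinct_Q] by (auto simp: tree_list_def s')
  \<comment> \<open>\<open>own i\<close> collects the former slots whose points may end up in slot
    \<open>i\<close>; with the share \<open>sh i\<close> they confine the new tree. Disjoint owners
    then give disjoint trees.\<close>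
  define own where "own i = (if i \<in> ?new then set (merged_into F F' i) else {i} - ?old)" for i
  define sh where "sh i = (if i \<in> ?new then set (share X F F' P' i) else {})" for i
  define U where "U i = (\<Union>j\<in>own i. set (tree_list s j))" for i
  have set_s': "set (tree_list s' i) \<subseteq> U i \<union> sh i" for i
    by (auto simp: tree_s' own_def U_def sh_def Q_def merged_points_def set_old_slots set_new_slots
        simp flip: F_def)
  have sh: "sh i \<subseteq> set P'" for i
    using set_share_subset [of X F F' P' i] by (simp add: sh_def)
  have own_disj: "own i \<inter> own j = {}" if "i \<noteq> j" for i j
    using merged_into_disjoint [of i F F' j] that
    by (auto simp: own_def merged_into_def)
  have disj_U: "set P' \<inter> U i = {}" for i
    using disj_P' by (auto simp: U_def)
  have trees_s': "set (tree_list s' i) \<inter> set (tree_list s' j) = {}" if "i \<noteq> j" for i j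
  proof -
    have "U i \<inter> U j = {}"
    proof (rule equals0I)
      fix x assume "x \<in> U i \<inter> U j"
      then obtain a c where ac: "a \<in> own i" "c \<in> own j"
        "x \<in> set (tree_list s a)" "x \<in> set (tree_list s c)"
        by (auto simp: U_def)
      then have "a \<noteq> c" using own_disj [OF that] by blast
      then show False using trees_disjoint [OF ctx] ac(3,4) by blast
    qed
    moreover have "sh i \<inter> U j = {}" "sh j \<inter> U i = {}"
      using disj_U sh [of i] sh [of j] by blast+
    moreover have "sh i \<inter> sh j = {}"
      using share_disjoint [OF fb(2) _ _ that, of F F' X] by (simp add: sh_def)
    ultimately show ?thesis
      using set_s' [of i] set_s' [of j] by blast
  qed
  have buf_s': "set (points_opt buf) \<inter> set (tree_list s' i) = {}" for i
  proof -
    have "set (points_opt buf) \<inter> U i = {}"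
      using disj_buf' by (auto simp: U_def)
    moreover have "set (points_opt buf) \<inter> sh i = {}"
      using fb(4) sh [of i] by blast
    ultimately show ?thesis
      using set_s' [of i] by blast
  qed
  have "valid s'"
    unfolding valid_def
  proof (intro conjI allI impI)
    show "finite (dom (slot s'))" by (simp add: dom_s')
    show "valid_buffer (buffer s')" using fb(1) by (simp add: s')
  next
    fix i t c assume t: "slot s' i = Some (t, c)"
    have "sound b (i + X + 1) t \<and> c = length (points t) \<and> 2 ^ i * X \<le> 2 * c \<and> c \<le> 2 ^ i * X"
    proof (cases "i \<in> ?new")
      case True
      then have "t = val (build (Q i))" "c = length (Q i)"
        using t by (auto simp: s' split: if_splits)
      then show ?thesis
        using capacity [OF True] sound_build distinct_Q build_points by auto
    next
      case False
      then have "slot s i = Some (t, c)"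
        using t by (auto simp: s' split: if_splits)
      then show ?thesis
        using valid by (auto simp: valid_def)
    qed
    then show "sound b (i + X + 1) t" "c = length (points t)" "2 ^ i * X \<le> 2 * c" "c \<le> 2 ^ i * X"
      by auto
  next
    show "set (tree_list s' i) \<inter> set (tree_list s' j) = {}" if "i \<noteq> j" for i j
      using trees_s' [OF that] .
    show "set (points_opt (buffer s')) \<inter> set (tree_list s' i) = {}" for i
      using buf_s' [of i] by (simp add: s')
  qed
  \<comment> \<open>Slots set in both counters keep their trees; the deficits of the new slots are
    those of the old slots merged into them.\<close>
  moreover have "deficit X s' = deficit X s"
  proof -
    let ?both = "{i. bit F i \<and> bit F' i}"
    have split: "{i. bit F' i} = ?both \<union> ?new" "{i. bit F i} = ?both \<union> ?old"
      by (auto simp: set_new_slots set_old_slots)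
    have "deficit X s' = (\<Sum>i\<in>?both. 2 ^ i * X - length (tree_list s' i))
        + (\<Sum>i\<in>?new. 2 ^ i * X - length (tree_list s' i))"
      unfolding deficit_def flags_s' split(1)
      by (rule sum.union_disjoint) (auto simp: set_new_slots)
    also have "(\<Sum>i\<in>?both. 2 ^ i * X - length (tree_list s' i))
        = (\<Sum>i\<in>?both. 2 ^ i * X - length (tree_list s i))"
      by (intro sum.cong) (auto simp: tree_s' set_new_slots set_old_slots)
    also have "(\<Sum>i\<in>?new. 2 ^ i * X - length (tree_list s' i))
        = (\<Sum>i\<in>?new. \<Sum>j\<in>set (merged_into F F' i). 2 ^ j * X - length (tree_list s j))"
      using capacity(1) by (intro sum.cong) (auto simp: tree_s' set_new_slots set_old_slots)
    also have "\<dots> = (\<Sum>j\<in>?old. 2 ^ j * X - length (tree_list s j))"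
      by (rule sum_merged_into) (simp add: F'_def)
    also have "(\<Sum>i\<in>?both. 2 ^ i * X - length (tree_list s i)) + \<dots> = deficit X s"
      unfolding deficit_def F_def [symmetric] split(2)
      by (rule sum.union_disjoint [symmetric]) (auto simp: set_old_slots)
    finally show ?thesis .
  qed
  moreover have "k \<le> length P div X + 1" "P = [] \<longrightarrow> k = 0"
    using fb(7,8) by (auto simp: k_def)
  moreover have "work (batch_insert build X P s) + ?K * credit F'
      \<le> length P + ?K * (credit F + 2 * k * (L + 1)\<^sup>2) + L + (9 + 7 * X + KW)"
  proof -
    have "work (batch_insert build X P s) = work (fill_buffer build X P s) + (1 + L)
        + (1 + (\<Sum>i\<leftarrow>new_slots F F'. 1 + work (rebuild s F' P' i)))"
      unfolding batch_insert_eq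
      by (simp add: case_prod_beta Let_def L_def F'_def flip: buf_def P'_def k_def F_def)
    moreover have "(\<Sum>i\<leftarrow>new_slots F F'. 1 + work (rebuild s F' P' i))
        \<le> ?K * (\<Sum>i\<in>?new. 2 ^ i * (i + 1))"
    proof -
      have "(\<Sum>i\<leftarrow>new_slots F F'. 1 + work (rebuild s F' P' i))
          = (\<Sum>i\<in>?new. 1 + work (rebuild s F' P' i))"
        by (rule sum_list_distinct_conv_sum_set) simp
      also have "\<dots> \<le> (\<Sum>i\<in>?new. ?K * (2 ^ i * (i + 1)))"
        by (intro sum_mono work_re)
      finally show ?thesis by (simp only: sum_distrib_left)
    qed
    \<comment> \<open>The credit released by the counter pays for all rebuilt trees.\<close>
    moreover have "?K * (\<Sum>i\<in>?new. 2 ^ i * (i + 1)) + ?K * credit F'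
        \<le> ?K * (credit F + 2 * k * (L + 1)\<^sup>2)"
      using mult_le_mono2 [OF credit_add [of F k], of ?K]
      by (simp only: F'_def [symmetric] L_def [symmetric] distrib_left add.commute)
    ultimately show ?thesis
      using fb(9) by linarith
  qed
  moreover have "depth (batch_insert build X P s)
      \<le> floorlog 2 (length P) + 7 * L + KD * (L * floorlog 2 L) + (20 + 8 * X + 2 * b + KD)"
  proof -
    have "depth (batch_insert build X P s) = depth (fill_buffer build X P s) + (1 + L)
        + depth (pmap (rebuild s F' P') (new_slots F F'))"
      unfolding batch_insert_eq
      by (simp add: case_prod_beta Let_def L_def F'_def flip: buf_def P'_def k_def F_def)
    moreover have "depth (pmap (rebuild s F' P') (new_slots F F'))
        \<le> 1 + floorlog 2 (length (new_slots F F')) + (5 * L + 3 * X + b + 9 + KD * (L * floorlog 2 L))"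
      by (intro depth_pmap_le depth_re)
    moreover have "floorlog 2 (length (new_slots F F')) \<le> L"
      using floorlog2_le [of "length (new_slots F F')"] length_new_slots [of F F'] by (simp add: L_def)
    ultimately show ?thesis
      using fb(10) by linarith
  qed
  ultimately show ?thesis
    unfolding flags_s' by (auto simp: F'_def F_def L_def)
qed

end

section \<open>Batch deletion\<close>

context kd_construction
begin

text \<open>\<open>q\<close> counts the points gathered for reinsertion. The work is charged to
  deleted and reinserted points alike; the deficit inequality makes the latter payable, since each
  of them takes one unit off the deficit bound.\<close>

lemma batch_delete_bounds:
  assumes valid: "valid s" and P: "P \<noteq> []"
  defines "s' \<equiv> val (batch_delete build X P s)" and "L \<equiv> floorlog 2 (flags s)"
    and "K \<equiv> 6 + 5 * X + KW"
  shows "\<exists>q. valid s' \<and> flags s' \<le> flags s \<and> deficit X s' + q \<le> deficit X s + length P \<and>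
    work (batch_delete build X P s) + K * credit (flags s')
      \<le> K * credit (flags s)
        + (2 * (b + 4) * (X + 2) + 24 + 4 * K + 7 * X + KW) * (L + 1)\<^sup>2 * (length P + q) \<and>
    depth (batch_delete build X P s)
      \<le> floorlog 2 (length P) + 19 * L + KD * (L * floorlog 2 L) + (29 + 15 * X + 5 * b + KD)"
proof -
  define F where "F = flags s"
  define T where "T i = fst (the (slot s i))" for i
  define R where "R i = fst (val (erase P (T i)))" for i
  define c where "c i = length (points_opt (R i))" for i
  define low where "low i \<longleftrightarrow> 2 * c i < 2 ^ i * X" for i
  define lows where "lows = filter low (ones F)"
  define highs where "highs = filter (\<lambda>i. \<not> low i) (ones F)"
  define Q where "Q = concat (map (\<lambda>i. points_opt (R i)) lows)"
  define buf where "buf = val (erase_buffer P (buffer s))"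
  define s1 :: "'d bdl" where "s1 = \<lparr>buffer = buf,
    slot = (\<lambda>i. if i \<in> set highs then Some (the (R i), c i) else None)\<rparr>"
  define q where "q = length Q"
  have L: "L = floorlog 2 F" by (simp add: L_def F_def)
  have slot_s: "slot s i = Some (T i, length (points (T i)))" "tree_list s i = points (T i)"
    "sound b (i + X + 1) (T i)" if "bit F i" for i
    using that valid_bit [OF valid, of i] valid unfolding F_def T_def tree_list_def
    by (auto simp: valid_def)
  have R: "pred_option (sound b (i + X + 1)) (R i)" "set (points_opt (R i)) \<subseteq> set (tree_list s i)"
    "c i + snd (val (erase P (T i))) = length (tree_list s i)"
    "snd (val (erase P (T i))) \<le> card (set P \<inter> set (tree_list s i))" if "bit F i" for i
    using erase_result [OF slot_s(3) [OF that], of P] slot_s(2) [OF that]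
    by (simp_all add: R_def c_def)
  have distinct_R: "distinct (points_opt (R i))" if "bit F i" for i
    using R(1) [OF that] by (cases "R i") (auto simp: sound_def)
  have erase_slot: "val (erase_slot P s i) = (i, R i, c i)"
    "work (erase_slot P s i) = work (erase P (T i)) + 1"
    "depth (erase_slot P s i) = depth (erase P (T i)) + 1" if "bit F i" for i
    using slot_s(1) [OF that] R(3) [OF that] slot_s(2) [OF that]
    by (simp_all add: erase_slot_def case_prod_beta R_def)
  have ones: "i \<in> set (ones F) \<longleftrightarrow> bit F i" for i by (simp add: set_ones)
  have rest: "map (\<lambda>i. val (erase_slot P s i)) (ones F) = map (\<lambda>i. (i, R i, c i)) (ones F)"
    by (rule map_cong) (simp_all add: ones erase_slot)
  have flt: "filter (\<lambda>(i, t, c). 2 * c < 2 ^ i * X) (map (\<lambda>i. (i, R i, c i)) (ones F))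
        = map (\<lambda>i. (i, R i, c i)) lows"
    "filter (\<lambda>(i, t, c). \<not> 2 * c < 2 ^ i * X) (map (\<lambda>i. (i, R i, c i)) (ones F))
        = map (\<lambda>i. (i, R i, c i)) highs"
    by (simp_all add: filter_map comp_def lows_def highs_def low_def [abs_def])
  have highs: "i \<in> set highs \<longleftrightarrow> bit F i \<and> \<not> low i" for i
    by (simp add: highs_def ones)
  have lows: "i \<in> set lows \<longleftrightarrow> bit F i \<and> low i" for i
    by (auto simp: lows_def ones)
  \<comment> \<open>An emptied tree has size 0 and thus lies below half because \<open>X\<close> is
    positive, so every slot that is kept still holds a tree.\<close>
  have R_Some: "\<exists>t. R i = Some t" if "i \<in> set highs" for i
    using that X_pos by (cases "R i") (auto simp: highs low_def c_def)
  have s1: "\<lparr>buffer = buf,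
      slot = (\<lambda>i. case map_of (map (\<lambda>i. (i, R i, c i)) highs) i of
        Some (Some t, c) \<Rightarrow> Some (t, c) | _ \<Rightarrow> None)\<rparr> = s1"
    by (auto simp: s1_def map_of_map_restrict restrict_map_def fun_eq_iff dest: R_Some
        split: option.splits)
  define low_list where "low_list = map (\<lambda>i. (i, R i, c i)) lows"
  have eq: "val (batch_delete build X P s) = val (batch_insert build X Q s1)"
    "work (batch_delete build X P s) = 1 + L
      + (1 + work (erase_buffer P (buffer s)) + work (pmap (erase_slot P s) (ones F)))
      + (1 + length (ones F)) + work (pmap (\<lambda>(i, t, c). gather_opt t) low_list)
      + work (pconcat (map (\<lambda>i. points_opt (R i)) lows)) + work (batch_insert build X Q s1)"
    "depth (batch_delete build X P s) = 1 + L
      + (1 + max (depth (erase_buffer P (buffer s))) (depth (pmap (erase_slot P s) (ones F))))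
      + (1 + length (ones F)) + depth (pmap (\<lambda>(i, t, c). gather_opt t) low_list)
      + depth (pconcat (map (\<lambda>i. points_opt (R i)) lows)) + depth (batch_insert build X Q s1)"
    unfolding batch_delete_def Let_def low_list_def
    by (simp_all add: rest flt s1 comp_def L flip: F_def buf_def Q_def del: comp_pconcat(2,3))

  have vbuf: "valid_buffer (buffer s)" using valid by (simp add: valid_def)
  have buf: "valid_buffer buf" "set (points_opt buf) \<subseteq> set (points_opt (buffer s))"
    "work (erase_buffer P (buffer s)) \<le> (b + 4) * (X + 2) * length P"
    "depth (erase_buffer P (buffer s)) \<le> 4 + floorlog 2 (length P) + 3 * X + 2 * b"
  proof (atomize (full), cases "buffer s")
    case None
    then show "(valid_buffer buf \<and> set (points_opt buf) \<subseteq> set (points_opt (buffer s))) \<and>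
      work (erase_buffer P (buffer s)) \<le> (b + 4) * (X + 2) * length P \<and>
      depth (erase_buffer P (buffer s)) \<le> 4 + floorlog 2 (length P) + 3 * X + 2 * b"
      using X_pos by (simp add: buf_def erase_buffer_def valid_buffer_def)
  next
    case (Some t)
    then have t: "sound b (X + 1) t" "length (points t) < X"
      using vbuf by (auto simp: valid_buffer_def)
    then show "(valid_buffer buf \<and> set (points_opt buf) \<subseteq> set (points_opt (buffer s))) \<and>
      work (erase_buffer P (buffer s)) \<le> (b + 4) * (X + 2) * length P \<and>
      depth (erase_buffer P (buffer s)) \<le> 4 + floorlog 2 (length P) + 3 * X + 2 * b"
      using erase_result [OF t(1), of P] work_erase [OF t(1) P] depth_erase [OF t(1), of P] Some
      by (auto simp: buf_def erase_buffer_def valid_buffer_def case_prod_beta)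
  qed

  have trees: "set (tree_list s i) \<inter> set (tree_list s j) = {}" if "i \<noteq> j" for i j
    using valid that by (simp add: valid_def)
  have tree_s1: "tree_list s1 i = (if i \<in> set highs then points_opt (R i) else [])" for i
    using R_Some [of i] by (auto simp: tree_list_def s1_def)
  have sub_s1: "set (tree_list s1 i) \<subseteq> set (tree_list s i)" for i
    using R(2) [of i] by (cases "bit F i") (auto simp: tree_s1 highs)
  have dom_s1: "slot s1 i \<noteq> None \<longleftrightarrow> i \<in> set highs" for i
    by (simp add: s1_def)
  have valid_s1: "valid s1"
    unfolding valid_def
  proof (intro conjI allI impI)
    have "dom (slot s1) = set highs" using dom_s1 by auto
    then show "finite (dom (slot s1))" by simp
    show "valid_buffer (buffer s1)" using buf by (simp add: s1_def)
  next
    fix i t n assume "slot s1 i = Some (t, n)"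
    then have i: "i \<in> set highs" "R i = Some t" "n = c i"
      using R_Some [of i] by (auto simp: s1_def split: if_splits)
    have "c i \<le> length (tree_list s i)" "length (tree_list s i) \<le> 2 ^ i * X"
      using R(3) [of i] valid_length(2) [OF valid, of i] i(1) by (auto simp: highs F_def)
    then show "sound b (i + X + 1) t" "n = length (points t)" "2 ^ i * X \<le> 2 * n" "n \<le> 2 ^ i * X"
      using i R(1) [of i] by (auto simp: highs low_def c_def)
  next
    show "set (tree_list s1 i) \<inter> set (tree_list s1 j) = {}" if "i \<noteq> j" for i j
      using sub_s1 [of i] sub_s1 [of j] trees [OF that] by blast
    show "set (points_opt (buffer s1)) \<inter> set (tree_list s1 i) = {}" for i
    proof -
      have "set (points_opt (buffer s)) \<inter> set (tree_list s i) = {}"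
        using valid by (simp add: valid_def)
      then show ?thesis using sub_s1 [of i] buf(2) by (auto simp: s1_def)
    qed
  qed
  have distinct_concat: "distinct (concat (map (\<lambda>i. points_opt (R i)) js))"
    if "distinct js" "\<And>j. j \<in> set js \<Longrightarrow> bit F j" for js
    using that
  proof (induction js)
    case (Cons j js)
    have "set (points_opt (R j)) \<inter> set (points_opt (R j')) = {}" if "j' \<in> set js" for j'
      using Cons.prems that R(2) [of j] R(2) [of j'] trees [of j j'] by auto
    then have "set (points_opt (R j)) \<inter> set (concat (map (\<lambda>i. points_opt (R i)) js)) = {}"
      by auto
    then show ?case using Cons distinct_R [of j] by simp
  qed simp
  have distinct_Q: "distinct Q"
    unfolding Q_def by (rule distinct_concat) (auto simp: lows, simp add: lows_def)
  have Q_buf: "set Q \<inter> set (points_opt (buffer s1)) = {}"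
  proof -
    have "set (points_opt (R i)) \<inter> set (points_opt (buffer s1)) = {}" if "i \<in> set lows" for i
      using valid R(2) [of i] that buf(2) by (fastforce simp: valid_def s1_def lows)
    then show ?thesis by (auto simp: Q_def)
  qed
  have Q_trees: "set Q \<inter> set (tree_list s1 i) = {}" for i
  proof -
    have "set (points_opt (R j)) \<inter> set (tree_list s1 i) = {}" if "j \<in> set lows" for j
    proof (cases "i = j")
      case True
      then show ?thesis using that by (simp add: tree_s1 highs lows)
    next
      case False
      then show ?thesis using sub_s1 [of i] R(2) [of j] that trees [of i j] by (auto simp: lows)
    qed
    then show ?thesis by (auto simp: Q_def)
  qed

  obtain k where ins: "valid s'" "flags s' = flags s1 + k" "deficit X s' = deficit X s1"
    "k \<le> q div X + 1" "Q = [] \<longrightarrow> k = 0"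
    "work (batch_insert build X Q s1) + K * credit (flags s')
      \<le> q + K * (credit (flags s1) + 2 * k * (floorlog 2 (flags s') + 1)\<^sup>2)
        + floorlog 2 (flags s') + (9 + 7 * X + KW)"
    "depth (batch_insert build X Q s1)
      \<le> floorlog 2 q + 7 * floorlog 2 (flags s')
        + KD * (floorlog 2 (flags s') * floorlog 2 (floorlog 2 (flags s')))
        + (20 + 8 * X + 2 * b + KD)"
    using batch_insert_bounds [OF valid_s1 distinct_Q Q_buf Q_trees]
    unfolding s'_def eq(1) q_def K_def by blast

  have bits_s1: "{i. bit (flags s1) i} = set highs"
    using valid_bit [OF valid_s1] dom_s1 by simp
  have bits_F: "{i. bit F i} = set highs \<union> set lows" "set highs \<inter> set lows = {}"
    by (auto simp: highs lows)
  have sum_F: "(\<Sum>i\<in>set highs. f i) + (\<Sum>i\<in>set lows. f i) = (\<Sum>i | bit F i. f i :: nat)" for f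
    unfolding bits_F(1) by (rule sum.union_disjoint [symmetric]) (use bits_F(2) in auto)
  define E where "E = (\<Sum>i\<in>set lows. 2 ^ i :: nat)"
  have F_eq: "flags s1 + E = F"
    using sum_F [of "\<lambda>i. 2 ^ i"] sum_bits [of F] sum_bits [of "flags s1"]
    by (simp add: E_def bits_s1)
  have distinct_lows: "distinct lows" by (simp add: lows_def)
  then have q: "q = (\<Sum>i\<in>set lows. c i)"
    by (simp add: q_def Q_def length_concat comp_def sum_list_distinct_conv_sum_set flip: c_def)
  have "2 * q \<le> E * X"
    unfolding q E_def sum_distrib_left sum_distrib_right
    by (intro sum_mono) (simp add: lows low_def)
  \<comment> \<open>The emptied slots free \<open>E\<close> units of the counter but give fewer than
    \<open>E * X / 2\<close> points. So \<open>q div X\<close> is below \<open>E / 2\<close>, which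
    leaves room for the extra block from the buffer.\<close>
  have "k \<le> E"
  proof (cases "lows = []")
    case True
    then show ?thesis using ins(5) by (simp add: Q_def)
  next
    case False
    have "(\<Sum>i\<in>set lows. 2 * c i) < (\<Sum>i\<in>set lows. 2 ^ i * X)"
      using False by (intro sum_strict_mono) (auto simp: lows low_def)
    then have "2 * q < E * X"
      by (simp add: q E_def sum_distrib_left sum_distrib_right)
    moreover have "2 * (q div X * X) \<le> 2 * q" by simp
    ultimately have "2 * (q div X) * X < E * X" by linarith
    then have "2 * (q div X) < E" by simp
    then show ?thesis using ins(4) by linarith
  qed
  then have flags_le: "flags s' \<le> F"
    using F_eq ins(2) by linarith
  have "deficit X s' + q \<le> deficit X s + length P"
  proof -
    define m where "m i = snd (val (erase P (T i)))" for i
    have 1: "length (tree_list s i) \<le> 2 ^ i * X" "c i + m i = length (tree_list s i)" if "bit F i" for i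
      using valid_length [OF valid, of i] R(3) [OF that] that by (simp_all add: F_def m_def)
    have "deficit X s1 = (\<Sum>i\<in>set highs. 2 ^ i * X - c i)"
      unfolding deficit_def bits_s1 by (intro sum.cong) (simp_all add: tree_s1 c_def)
    moreover have "2 ^ i * X - c i \<le> (2 ^ i * X - length (tree_list s i)) + m i" if "i \<in> set highs" for i
      using 1 [of i] that by (simp add: highs)
    \<comment> \<open>A tree below half has more free capacity than points, and that free capacity
      is its former deficit plus the points just removed.\<close>
    moreover have "c i \<le> (2 ^ i * X - length (tree_list s i)) + m i" if "i \<in> set lows" for i
      using 1 [of i] that unfolding lows low_def by linarith
    ultimately have "deficit X s' + q \<le>
        (\<Sum>i\<in>set highs. (2 ^ i * X - length (tree_list s i)) + m i) +
        (\<Sum>i\<in>set lows. (2 ^ i * X - length (tree_list s i)) + m i)"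
      unfolding q ins(3) by (auto intro!: add_mono sum_mono)
    also have "\<dots> = deficit X s + (\<Sum>i | bit F i. m i)"
      unfolding sum_F deficit_def by (simp add: sum.distrib F_def)
    also have "(\<Sum>i | bit F i. m i) \<le> (\<Sum>i | bit F i. card (set P \<inter> set (tree_list s i)))"
      using R(4) by (intro sum_mono) (simp add: m_def)
    also have "\<dots> = card (\<Union>i\<in>{i. bit F i}. set P \<inter> set (tree_list s i))"
      using trees by (intro card_UN_disjoint [symmetric]) auto
    also have "\<dots> \<le> card (set P)"
      by (intro card_mono) auto
    also have "\<dots> \<le> length P" by (rule card_length)
    finally show ?thesis by simp
  qed

  have L_ge: "i + 1 \<le> L" if "bit F i" for i
    using floorlog2_gt_bit [OF that] by (simp add: L)
  have len_ones: "length (ones F) \<le> L" unfolding L by (rule length_ones)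
  have len_lows: "length lows \<le> L"
    unfolding lows_def using len_ones length_filter_le [of low "ones F"] by linarith
  have L': "floorlog 2 (flags s') \<le> L"
    unfolding L by (intro floorlog_mono flags_le)
  have low_list: "length low_list \<le> L" using len_lows by (simp add: low_list_def)
  have p1: "1 \<le> length P" using P by (simp add: Suc_le_eq)
  \<comment> \<open>The extra block from the buffer is charged to the gathered points, of which
    there is at least one; so the reinsertion becomes linear in \<open>q\<close>.\<close>
  have k2: "k \<le> 2 * q"
  proof (cases "Q = []")
    case True
    then show ?thesis using ins(5) by simp
  next
    case False
    then have "1 \<le> q" by (simp add: q_def Suc_le_eq)
    then show ?thesis using ins(4) div_le_dividend [of q X] by linarith
  qed
  define A where "A = (L + 1)\<^sup>2"
  have A: "1 \<le> A" "L + 1 \<le> A" "L * (L + 1) \<le> A" by (simp_all add: A_def power2_eq_square)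

  have work: "work (batch_delete build X P s) + K * credit (flags s')
      \<le> K * credit F + (2 * (b + 4) * (X + 2) + 24 + 4 * K + 7 * X + KW) * A * (length P + q)"
  proof -
    \<comment> \<open>Up to \<open>L\<close> trees of height at most \<open>L + X\<close> are
      searched, so a deleted point costs a squared logarithm even without reinsertion.\<close>
    have w1: "work (pmap (erase_slot P s) (ones F)) \<le> 1 + 2 * L + (b + 4) * (X + 2) * (A * length P)"
    proof -
      have "1 + work (erase_slot P s i) \<le> 2 + (b + 4) * (L + X + 1) * length P" if "i \<in> set (ones F)" for i
      proof -
        have i: "bit F i" using that by (simp add: ones)
        have "work (erase P (T i)) \<le> (b + 4) * (i + X + 1 + 1) * length P"
          by (rule work_erase [OF slot_s(3) [OF i] P])
        also have "\<dots> \<le> (b + 4) * (L + X + 1) * length P"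
          using L_ge [OF i] by (intro mult_le_mono) auto
        finally show ?thesis using erase_slot(2) [OF i] by simp
      qed
      then have "(\<Sum>i\<leftarrow>ones F. 1 + work (erase_slot P s i))
          \<le> (\<Sum>i\<leftarrow>ones F. 2 + (b + 4) * (L + X + 1) * length P)"
        by (intro sum_list_mono) blast
      also have "\<dots> \<le> L * (2 + (b + 4) * (L + X + 1) * length P)"
        using len_ones by (simp only: sum_list_triv mult_le_mono1 of_nat_id)
      also have "\<dots> = 2 * L + (b + 4) * (L * (L + 1) + L * X) * length P"
        by (simp add: algebra_simps)
      also have "\<dots> \<le> 2 * L + (b + 4) * (A + A * X) * length P"
        using A by (intro add_left_mono mult_le_mono add_le_mono le_refl) auto
      also have "\<dots> \<le> 2 * L + (b + 4) * (X + 2) * (A * length P)"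
        by (simp add: algebra_simps)
      finally show ?thesis by simp
    qed
    have w2: "work (pmap (\<lambda>(i, t, c). gather_opt t) low_list) \<le> 1 + L + 4 * q"
    proof -
      have "work (pmap (\<lambda>(i, t, c). gather_opt t) low_list) = 1 + (\<Sum>i\<leftarrow>lows. 1 + work (gather_opt (R i)))"
        by (simp add: low_list_def comp_def)
      also have "(\<Sum>i\<leftarrow>lows. 1 + work (gather_opt (R i))) \<le> (\<Sum>i\<leftarrow>lows. 1 + 4 * c i)"
        using gather_opt_bounds(2) [OF R(1)] by (intro sum_list_mono) (auto simp: c_def lows)
      also have "\<dots> = length lows + 4 * q"
        by (simp add: q sum_list_distinct_conv_sum_set sum_Suc distinct_card sum_distrib_left distinct_lows)
      finally show ?thesis using len_lows by simp
    qed
    have w3: "work (pconcat (map (\<lambda>i. points_opt (R i)) lows)) \<le> 1 + L + q"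
      using len_lows by (simp add: q_def Q_def)
    have "2 * k * (floorlog 2 (flags s') + 1)\<^sup>2 \<le> 2 * (2 * q) * (L + 1)\<^sup>2"
      using k2 L' by (intro mult_le_mono power_mono) auto
    also have "\<dots> = 4 * (A * q)" by (simp add: A_def)
    finally have "credit (flags s1) + 2 * k * (floorlog 2 (flags s') + 1)\<^sup>2 \<le> credit F + 4 * (A * q)"
      using credit_mono_bits [of "flags s1" F] bits_s1 bits_F(1) by (simp add: add_mono)
    then have "K * (credit (flags s1) + 2 * k * (floorlog 2 (flags s') + 1)\<^sup>2)
        \<le> K * (credit F + 4 * (A * q))"
      by (rule mult_le_mono2)
    then have w4: "work (batch_insert build X Q s1) + K * credit (flags s')
        \<le> q + (K * credit F + 4 * K * (A * q)) + L + (9 + 7 * X + KW)"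
      using ins(6) L' by (simp add: distrib_left)
    have buf_le: "(b + 4) * (X + 2) * length P \<le> (b + 4) * (X + 2) * (A * length P)"
      using A(1) by (intro mult_le_mono) auto
    \<comment> \<open>The batch is nonempty, so \<open>L + 1 <= A <= p\<close>, and \<open>p\<close>
      absorbs all terms that depend on \<open>L\<close> alone.\<close>
    define p where "p = A * length P"
    have p: "1 \<le> p" "L + 1 \<le> p" using A p1 mult_le_mono [of _ A 1 "length P"] by (auto simp: p_def)
    have c1: "(7 * X + KW) * 1 \<le> (7 * X + KW) * p" using p(1) by (rule mult_le_mono2)
    have qA: "q \<le> A * q" using A(1) by simp
    have "work (batch_delete build X P s) + K * credit (flags s')
        \<le> K * credit F + 2 * ((b + 4) * (X + 2) * p) + (17 + 7 * L) + (7 * X + KW) + (6 * q + 4 * K * (A * q))"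
      unfolding eq(2) using w1 w2 w3 w4 buf(3) buf_le len_ones unfolding p_def [symmetric] by linarith
    also have "\<dots> \<le> K * credit F + 2 * ((b + 4) * (X + 2) * p) + 24 * p + (7 * X + KW) * p
        + (6 * (A * q) + 4 * K * (A * q))"
      using p c1 qA by (intro add_le_mono order_refl) simp_all
    also have "\<dots> \<le> K * credit F + (2 * (b + 4) * (X + 2) + 24 + 4 * K + 7 * X + KW) * (p + A * q)"
      by (simp add: algebra_simps)
    also have "p + A * q = A * (length P + q)" by (simp add: p_def algebra_simps)
    finally show ?thesis by (simp only: mult.assoc)
  qed
  have depth: "depth (batch_delete build X P s)
      \<le> floorlog 2 (length P) + 19 * L + KD * (L * floorlog 2 L) + (29 + 15 * X + 5 * b + KD)"
  proof -
    have "depth (erase_slot P s i) \<le> 2 + floorlog 2 (length P) + 3 * L + 3 * X + 2 * b"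
      if "i \<in> set (ones F)" for i
    proof -
      have i: "bit F i" using that by (simp add: ones)
      show ?thesis
        using depth_erase [OF slot_s(3) [OF i], of P] L_ge [OF i] erase_slot(3) [OF i] by simp
    qed
    then have "depth (pmap (erase_slot P s) (ones F)) \<le> 1 + floorlog 2 (length (ones F))
        + (2 + floorlog 2 (length P) + 3 * L + 3 * X + 2 * b)"
      by (rule depth_pmap_le)
    then have d1: "max (depth (erase_buffer P (buffer s))) (depth (pmap (erase_slot P s) (ones F)))
        \<le> 4 + floorlog 2 (length P) + 4 * L + 3 * X + 2 * b"
      using floorlog2_le [of "length (ones F)"] len_ones buf(4) by simp
    have "depth (case x of (i, t, c) \<Rightarrow> gather_opt t) \<le> 2 * L + 2 * X + b" if "x \<in> set low_list" for x
      using that gather_opt_bounds(3) [OF R(1)] L_ge by (fastforce simp: low_list_def lows)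
    then have "depth (pmap (\<lambda>(i, t, c). gather_opt t) low_list)
        \<le> 1 + floorlog 2 (length low_list) + (2 * L + 2 * X + b)"
      by (rule depth_pmap_le)
    then have d2: "depth (pmap (\<lambda>(i, t, c). gather_opt t) low_list) \<le> 1 + 3 * L + 2 * X + b"
      using floorlog2_le [of "length low_list"] low_list by linarith
    \<comment> \<open>The gathered points lie in trees of total capacity at most
      \<open>F * X\<close>, so \<open>q\<close> has at most \<open>L + X\<close> binary
      digits.\<close>
    have "q \<le> F * X"
      using \<open>2 * q \<le> E * X\<close> mult_le_mono1 [of E F X] F_eq by linarith
    also have "\<dots> < 2 ^ L * 2 ^ X"
      unfolding L using less_two_power_floorlog [of F] less_exp [of X]
      by (intro mult_strict_mono) auto
    finally have q_L: "floorlog 2 q \<le> L + X"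
      by (intro floorlog_leI) (auto simp: power_add)
    have d3: "depth (pconcat (map (\<lambda>i. points_opt (R i)) lows)) \<le> 1 + 2 * L + X"
      using floorlog2_add_le [of q "length lows"] q_L len_lows by (simp add: q_def Q_def add.commute)
    have "KD * (floorlog 2 (flags s') * floorlog 2 (floorlog 2 (flags s'))) \<le> KD * (L * floorlog 2 L)"
      using L' by (intro mult_le_mono floorlog_mono) auto
    then have "depth (batch_insert build X Q s1) \<le> 8 * L + KD * (L * floorlog 2 L) + (20 + 9 * X + 2 * b + KD)"
      using ins(7) q_L L' by linarith
    then show ?thesis
      unfolding eq(3) using d1 d2 d3 len_ones by linarith
  qed
  show ?thesis
    using ins(1) flags_le \<open>deficit X s' + q \<le> deficit X s + length P\<close> work depth
    unfolding F_def A_def by blast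
qed

end

section \<open>Amortization\<close>

text \<open>A smooth substitute for \<open>(floorlog 2 F + 1)^2\<close>. The latter jumps at powers
  of two, where a single added block would raise the price of up to \<open>X * F\<close> units of
  deficit by a logarithm each.\<close>

definition weight :: "nat \<Rightarrow> real" where
  "weight F = (1 + log 2 (real F + 1))\<^sup>2"

lemma weight_ge_1: "1 \<le> weight F"
  by (simp add: weight_def one_le_power)

lemma weight_mono: "F \<le> G \<Longrightarrow> weight F \<le> weight G"
  unfolding weight_def by (intro power_mono add_left_mono) auto

lemma floorlog2_le_log: "real (floorlog 2 F) \<le> 1 + log 2 (real F + 1)"
proof (cases "F = 0")
  case False
  then have "2 ^ (floorlog 2 F - 1) \<le> F"
    using floorlog_bounds [of F 2] by simp
  then have "(2::real) ^ (floorlog 2 F - 1) \<le> real F"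
    by (metis of_nat_le_iff of_nat_numeral of_nat_power)
  then have "2 powr real (floorlog 2 F - 1) \<le> real F + 1"
    using powr_realpow [of 2 "floorlog 2 F - 1"] by linarith
  then have "real (floorlog 2 F - 1) \<le> log 2 (real F + 1)"
    by (simp add: le_log_iff)
  then show ?thesis by linarith
qed (simp add: floorlog_def)

lemma floorlog2_square_le_weight: "(real (floorlog 2 F) + 1)\<^sup>2 \<le> 4 * weight F"
proof -
  have "0 \<le> log 2 (real F + 1)" by simp
  then have "real (floorlog 2 F) + 1 \<le> 2 * (1 + log 2 (real F + 1))"
    using floorlog2_le_log [of F] unfolding distrib_left by linarith
  then have "(real (floorlog 2 F) + 1)\<^sup>2 \<le> (2 * (1 + log 2 (real F + 1)))\<^sup>2"
    by (intro power_mono) auto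
  also have "\<dots> = 4 * weight F" by (simp only: weight_def power_mult_distrib) simp
  finally show ?thesis .
qed

lemma log2_le_double: "log 2 (1 + x) \<le> 2 * x" if "0 \<le> x" for x :: real
proof -
  \<comment> \<open>This is \<open>ln (1 - 1/2) <= - 1/2\<close>.\<close>
  have "1 / 2 \<le> ln (2::real)"
    using ln_add_one_self_le_self2 [of "-1/2"] by (simp add: ln_div)
  moreover have "ln (1 + x) \<le> x" using that by (rule ln_add_one_self_le_self)
  ultimately have "ln (1 + x) \<le> 2 * x * ln 2"
    using mult_left_mono [of "1/2" "ln 2" "2 * x"] that by linarith
  then show ?thesis by (simp add: log_def field_simps)
qed

text \<open>With \<open>a\<close> and \<open>c\<close> the square roots of the two weights, the
  difference is \<open>(a - c) * (a + c)\<close>. For \<open>x = F + 1\<close>,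
  \<open>x * (a - c) = x * log 2 (1 + k / x)\<close> is at most \<open>2 * k\<close>, and
  \<open>a + c <= 2 * a <= 2 * a^2\<close>.\<close>

lemma weight_growth: "real F * (weight (F + k) - weight F) \<le> 4 * real k * weight (F + k)"
proof -
  define x where "x = real F + 1"
  define a where "a = 1 + log 2 (x + real k)"
  define c where "c = 1 + log 2 x"
  have x: "1 \<le> x" "real F \<le> x" by (simp_all add: x_def)
  have c: "1 \<le> c" "c \<le> a" using x by (auto simp: a_def c_def)
  have "x + real k = x * (1 + real k / x)" using x by (simp add: field_simps)
  moreover have "log 2 (x * (1 + real k / x)) = log 2 x + log 2 (1 + real k / x)"
    using x by (intro log_mult_pos) (auto intro: add_pos_nonneg)
  ultimately have "a - c = log 2 (1 + real k / x)"
    by (simp add: a_def c_def)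
  also have "\<dots> \<le> 2 * (real k / x)"
    using x by (intro log2_le_double) simp
  finally have "x * (a - c) \<le> 2 * real k"
    using x by (simp add: field_simps)
  moreover have "real F * (a - c) \<le> x * (a - c)"
    using x c by (intro mult_right_mono) auto
  ultimately have "real F * (a - c) * (a + c) \<le> 2 * real k * (2 * a)"
    using c by (intro mult_mono [of _ "2 * real k"]) auto
  also have "2 * real k * (2 * a) \<le> 4 * real k * a\<^sup>2"
  proof -
    have "a \<le> a\<^sup>2" using c by (simp add: self_le_power)
    then show ?thesis using mult_left_mono [of a "a\<^sup>2" "4 * real k"] by (simp add: mult.assoc)
  qed
  finally show ?thesis
    by (simp add: weight_def a_def c_def x_def power2_eq_square algebra_simps)
qed

section \<open>From the counter to the logarithm \<open>lg\<close>\<close>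

lemma log_2_4: "log 2 4 = (2 :: real)"
  using ln_realpow [of 2 2] by (simp add: log_def)

lemma lg_ge_2: "2 \<le> lg m"
proof -
  have "log 2 4 \<le> lg m" unfolding lg_def by (subst log_le_cancel_iff) auto
  then show ?thesis by (simp add: log_2_4)
qed

lemma log2_lg_ge_1: "1 \<le> log 2 (lg m)"
  using lg_ge_2 [of m] by simp

text \<open>The factor 2 in the hypothesis reflects trees that are only half full. The left side is
  at most \<open>3 + lg m\<close>, and \<open>lg m >= 2\<close>.\<close>

lemma log_double_le_lg:
  assumes "G \<le> 2 * m"
  shows "1 + log 2 (real G + 1) \<le> 3 * lg m"
proof -
  define M where "M = max 4 (real m)"
  have M: "4 \<le> M" "real G + 1 \<le> 4 * M" using assms by (auto simp: M_def)
  have "log 2 (real G + 1) \<le> log 2 (4 * M)"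
    using M by (subst log_le_cancel_iff) auto
  also have "\<dots> = 2 + lg m"
    using M by (subst log_mult_pos) (auto simp: lg_def M_def log_2_4)
  finally show ?thesis using lg_ge_2 [of m] by linarith
qed

lemma weight_le_lg:
  assumes "G \<le> 2 * m"
  shows "weight G \<le> 9 * (lg m)\<^sup>2"
proof -
  have "(1 + log 2 (real G + 1))\<^sup>2 \<le> (3 * lg m)\<^sup>2"
    using log_double_le_lg [OF assms] by (intro power_mono) auto
  then show ?thesis by (simp add: weight_def power_mult_distrib)
qed

lemma floorlog2_le_lg: "G \<le> 2 * m \<Longrightarrow> real (floorlog 2 G) \<le> 3 * lg m"
  using floorlog2_le_log log_double_le_lg order_trans by blast

lemma floorlog2_floorlog2_le_lg:
  assumes "G \<le> 2 * m"
  shows "real (floorlog 2 (floorlog 2 G)) \<le> 4 * log 2 (lg m)"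
proof -
  have "real (floorlog 2 G) + 1 \<le> 4 * lg m"
    using floorlog2_le_lg [OF assms] lg_ge_2 [of m] by simp
  then have "log 2 (real (floorlog 2 G) + 1) \<le> log 2 (4 * lg m)"
    using lg_ge_2 [of m] by (subst log_le_cancel_iff) auto
  also have "\<dots> = 2 + log 2 (lg m)"
    using lg_ge_2 [of m] by (subst log_mult_pos) (auto simp: log_2_4)
  finally show ?thesis
    using floorlog2_le_log [of "floorlog 2 G"] log2_lg_ge_1 [of m] by linarith
qed

text \<open>\<open>60 = 3 + 19 * 3\<close> and \<open>12 = 3 * 4\<close> collect the factors for
  single and double logarithms; the constant \<open>c\<close> is absorbed because the product of
  logarithms is at least 1.\<close>

lemma depth_le_lg:
  assumes "G \<le> 2 * m" "p \<le> 2 * m"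
    "d \<le> floorlog 2 p + 19 * floorlog 2 G + KD * (floorlog 2 G * floorlog 2 (floorlog 2 G)) + c"
  shows "real d \<le> real (60 + 12 * KD + c) * (lg m * log 2 (lg m))"
proof -
  define l where "l = lg m"
  define ll where "ll = log 2 (lg m)"
  have ge: "2 \<le> l" "1 \<le> ll" using lg_ge_2 log2_lg_ge_1 by (simp_all add: l_def ll_def)
  have "l \<le> l * ll"
    using ge mult_left_mono [of 1 ll l] by auto
  then have l1: "l \<le> l * ll" "1 \<le> l * ll" using ge(1) by linarith+
  have "real (floorlog 2 G * floorlog 2 (floorlog 2 G)) \<le> (3 * l) * (4 * ll)"
    unfolding of_nat_mult l_def ll_def using lg_ge_2 [of m]
    by (intro mult_mono floorlog2_le_lg floorlog2_floorlog2_le_lg assms) auto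
  then have 1: "real KD * real (floorlog 2 G * floorlog 2 (floorlog 2 G)) \<le> real KD * (12 * (l * ll))"
    by (intro mult_left_mono) auto
  have 2: "real (floorlog 2 p) \<le> 3 * (l * ll)" "real (floorlog 2 G) \<le> 3 * (l * ll)"
    using floorlog2_le_lg [OF assms(1)] floorlog2_le_lg [OF assms(2)] l1 by (auto simp: l_def)
  have 3: "real c \<le> real c * (l * ll)"
    using mult_left_mono [OF l1(2), of "real c"] by simp
  have "real d \<le> real (floorlog 2 p + 19 * floorlog 2 G
      + KD * (floorlog 2 G * floorlog 2 (floorlog 2 G)) + c)"
    using assms(3) by (rule of_nat_mono)
  also have "\<dots> = real (floorlog 2 p) + 19 * real (floorlog 2 G)
      + real KD * real (floorlog 2 G * floorlog 2 (floorlog 2 G)) + real c"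
    by simp
  also have "\<dots> \<le> 60 * (l * ll) + real KD * (12 * (l * ll)) + real c * (l * ll)"
    using 1 2 3 by linarith
  also have "\<dots> = real (60 + 12 * KD + c) * (l * ll)"
    by (simp add: algebra_simps)
  finally show ?thesis by (simp add: l_def ll_def)
qed

section \<open>The potential and the amortized cost of one update\<close>

context kd_construction
begin

text \<open>Half full, disjoint trees hold at least \<open>flags s * X / 2\<close> points.\<close>

lemma flags_le_contents:
  assumes "valid s"
  shows "flags s \<le> 2 * card (contents s)"
proof -
  let ?F = "{i. bit (flags s) i}"
  have "flags s \<le> flags s * X" using X_pos by simp
  also have "flags s * X = (\<Sum>i\<in>?F. 2 ^ i * X)"
    using sum_bits [of "flags s"] by (simp flip: sum_distrib_right)
  also have "\<dots> \<le> (\<Sum>i\<in>?F. 2 * length (tree_list s i))"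
    using valid_length [OF assms] by (intro sum_mono) auto
  also have "\<dots> = 2 * (\<Sum>i\<in>?F. card (set (tree_list s i)))"
    using valid_distinct [OF assms] by (simp add: sum_distrib_left distinct_card)
  also have "(\<Sum>i\<in>?F. card (set (tree_list s i))) = card (\<Union>i\<in>?F. set (tree_list s i))"
    using assms by (intro card_UN_disjoint [symmetric]) (auto simp: valid_def)
  also have "\<dots> \<le> card (contents s)"
  proof (rule card_mono)
    have *: "contents s = set (points_opt (buffer s)) \<union> (\<Union>i. set (tree_list s i))"
      by (simp add: contents_def opt_points_eq tree_list_def)
    have "(\<Union>i. set (tree_list s i)) = (\<Union>i\<in>?F. set (tree_list s i))"
      using valid_tree_list_empty [OF assms] by fastforce
    then show "finite (contents s)" by (simp add: *)
    show "(\<Union>i\<in>?F. set (tree_list s i)) \<subseteq> contents s" by (auto simp: *)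
  qed
  finally show ?thesis by simp
qed

lemma deficit_le: "deficit X s \<le> flags s * X"
proof -
  have "deficit X s \<le> (\<Sum>i | bit (flags s) i. 2 ^ i * X)"
    unfolding deficit_def by (intro sum_mono) auto
  also have "\<dots> = flags s * X"
    using sum_bits [of "flags s"] by (simp flip: sum_distrib_right)
  finally show ?thesis .
qed

text \<open>Rebuilding costs \<open>insert_cost\<close> per unit of \<open>2 ^ i * (i + 1)\<close>.
  \<open>delete_cost\<close> is the factor from \<open>batch_delete_bounds\<close>, where
  \<open>4 * insert_cost\<close> stands for the counter units of the reinsertion.\<close>

definition insert_cost :: nat where
  "insert_cost = 6 + 5 * X + KW"

definition delete_cost :: nat where
  "delete_cost = 2 * (b + 4) * (X + 2) + 24 + 4 * insert_cost + 7 * X + KW"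

text \<open>A unit of deficit has to pay \<open>delete_cost * (floorlog 2 F + 1)^2\<close> for one
  reinserted point; the factor 4 replaces this square by \<open>weight F\<close>.\<close>

definition potential :: "'d bdl \<Rightarrow> real" where
  "potential s = real insert_cost * real (credit (flags s)) +
     4 * real delete_cost * real (deficit X s) * weight (flags s)"

lemma potential_nonneg: "0 \<le> potential s"
  unfolding potential_def by (intro add_nonneg_nonneg mult_nonneg_nonneg) (auto simp: weight_def)

lemma insertion_bounds:
  assumes valid: "valid s" and adm: "admissible (Insertion P) s"
  defines "s' \<equiv> val (batch_insert build X P s)" and "m \<equiv> card (contents s) + length P"
  shows "valid s'"
    and "real (work (batch_insert build X P s)) + potential s'
      \<le> potential s + (14 + 7 * X + KW + 16 * insert_cost + 32 * delete_cost * X) * (real (length P) * weight (2 * m))"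
    and "real (depth (batch_insert build X P s))
      \<le> real (60 + 12 * KD + (20 + 8 * X + 2 * b + KD)) * (lg m * log 2 (lg m))"
proof -
  have P: "P \<noteq> []" "distinct P" "set P \<inter> contents s = {}"
    using adm by (auto simp: admissible_def)
  have disj: "set P \<inter> set (points_opt (buffer s)) = {}" "\<And>i. set P \<inter> set (tree_list s i) = {}"
    using P(3) by (auto simp: contents_def opt_points_eq tree_list_def)
  obtain k where ins: "valid s'" "flags s' = flags s + k" "deficit X s' = deficit X s"
    "k \<le> length P div X + 1"
    "work (batch_insert build X P s) + insert_cost * credit (flags s')
      \<le> length P + insert_cost * (credit (flags s) + 2 * k * (floorlog 2 (flags s') + 1)\<^sup>2)
        + floorlog 2 (flags s') + (9 + 7 * X + KW)"
    "depth (batch_insert build X P s)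
      \<le> floorlog 2 (length P) + 7 * floorlog 2 (flags s')
        + KD * (floorlog 2 (flags s') * floorlog 2 (floorlog 2 (flags s')))
        + (20 + 8 * X + 2 * b + KD)"
    using batch_insert_bounds [OF valid P(2) disj] unfolding s'_def insert_cost_def by blast
  show "valid s'" by fact
  have p1: "1 \<le> length P" using P by (simp add: Suc_le_eq)
  have k: "k \<le> length P + 1" using ins(4) div_le_dividend [of "length P" X] by linarith
  \<comment> \<open>The new counter is at most twice the contents plus \<open>length P + 1\<close>,
    and a nonempty batch absorbs the 1.\<close>
  have flags: "flags s' \<le> 2 * m"
    using flags_le_contents [OF valid] ins(2) k p1 by (simp add: m_def)
  show "real (depth (batch_insert build X P s))
      \<le> real (60 + 12 * KD + (20 + 8 * X + 2 * b + KD)) * (lg m * log 2 (lg m))"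
    using ins(6) by (intro depth_le_lg [OF flags, of "length P"]) (auto simp: m_def)
  define w where "w = weight (flags s')"
  define p where "p = real (length P)"
  define L where "L = real (floorlog 2 (flags s'))"
  have w: "1 \<le> w" by (simp add: w_def weight_ge_1)
  have p: "1 \<le> p" using p1 by (simp add: p_def)
  have pw: "1 \<le> p * w" "p \<le> p * w" "w \<le> p * w"
    using w p mult_mono [of 1 p 1 w] mult_left_mono [of 1 w p] mult_right_mono [of 1 p w] by auto
  have kp: "real k \<le> 2 * p" using k p1 by (simp add: p_def)
  have L: "(L + 1)\<^sup>2 \<le> 4 * w" unfolding L_def w_def by (rule floorlog2_square_le_weight)
  have L0: "0 \<le> L" by (simp add: L_def)
  then have "L \<le> (L + 1)\<^sup>2" by (simp add: power2_eq_square algebra_simps)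
  with L pw have L4: "L \<le> 4 * (p * w)" by linarith
  have "real k * (L + 1)\<^sup>2 \<le> (2 * p) * (4 * w)"
    using kp L by (intro mult_mono) auto
  then have c: "real insert_cost * (2 * real k * (L + 1)\<^sup>2) \<le> real insert_cost * (16 * (p * w))"
    by (intro mult_left_mono) auto
  have "real (work (batch_insert build X P s) + insert_cost * credit (flags s'))
      \<le> real (length P + insert_cost * (credit (flags s) + 2 * k * (floorlog 2 (flags s') + 1)\<^sup>2)
        + floorlog 2 (flags s') + (9 + 7 * X + KW))"
    using ins(5) by (rule of_nat_mono)
  then have "real (work (batch_insert build X P s)) + real insert_cost * real (credit (flags s'))
      \<le> p + real insert_cost * real (credit (flags s)) + real insert_cost * (2 * real k * (L + 1)\<^sup>2)
        + L + real (9 + 7 * X + KW)"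
    by (simp add: p_def L_def algebra_simps)
  moreover have "real (9 + 7 * X + KW) \<le> real (9 + 7 * X + KW) * (p * w)"
    using mult_left_mono [OF pw(1), of "real (9 + 7 * X + KW)"] by simp
  ultimately have 1: "real (work (batch_insert build X P s)) + real insert_cost * real (credit (flags s'))
      \<le> real insert_cost * real (credit (flags s)) + p * w + real insert_cost * (16 * (p * w)) + 4 * (p * w)
        + real (9 + 7 * X + KW) * (p * w)"
    using c L4 pw(2) by linarith
  \<comment> \<open>Repricing of the unchanged deficit. The final 32 is 4 from the potential, 4 from
    \<open>weight_growth\<close> and 2 from \<open>kp\<close>.\<close>
  have "real (deficit X s) * (w - weight (flags s)) \<le> real (flags s * X) * (w - weight (flags s))"
    using deficit_le [of s] weight_mono [of "flags s" "flags s'"] ins(2)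
    by (intro mult_right_mono) (auto simp: w_def simp del: of_nat_mult)
  also have "\<dots> = real X * (real (flags s) * (w - weight (flags s)))" by simp
  also have "\<dots> \<le> real X * (4 * real k * w)"
    unfolding w_def ins(2) by (intro mult_left_mono weight_growth) auto
  also have "\<dots> \<le> real X * (4 * (2 * p) * w)"
    using kp w by (intro mult_left_mono mult_right_mono) auto
  finally have "real (deficit X s) * w \<le> real (deficit X s) * weight (flags s) + 8 * real X * (p * w)"
    by (simp add: algebra_simps)
  then have "4 * real delete_cost * (real (deficit X s) * w)
      \<le> 4 * real delete_cost * (real (deficit X s) * weight (flags s) + 8 * real X * (p * w))"
    by (intro mult_left_mono) auto
  then have 2: "4 * real delete_cost * real (deficit X s') * w
      \<le> 4 * real delete_cost * real (deficit X s) * weight (flags s) + 32 * real delete_cost * real X * (p * w)"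
    by (simp add: ins(3) algebra_simps)
  have "real (work (batch_insert build X P s)) + potential s'
      \<le> potential s + (p * w + real insert_cost * (16 * (p * w)) + 4 * (p * w)
        + real (9 + 7 * X + KW) * (p * w) + 32 * real delete_cost * real X * (p * w))"
    using 1 2 unfolding potential_def w_def by linarith
  also have "p * w + real insert_cost * (16 * (p * w)) + 4 * (p * w)
        + real (9 + 7 * X + KW) * (p * w) + 32 * real delete_cost * real X * (p * w)
      = real (14 + 7 * X + KW + 16 * insert_cost + 32 * delete_cost * X) * (p * w)"
    by (simp add: algebra_simps)
  also have "\<dots> \<le> real (14 + 7 * X + KW + 16 * insert_cost + 32 * delete_cost * X) * (p * weight (2 * m))"
    using weight_mono [OF flags] p by (intro mult_left_mono) (auto simp: w_def)
  finally show "real (work (batch_insert build X P s)) + potential s'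
      \<le> potential s + (14 + 7 * X + KW + 16 * insert_cost + 32 * delete_cost * X) * (real (length P) * weight (2 * m))"
    by (simp add: p_def)
qed

lemma deletion_bounds:
  assumes valid: "valid s" and adm: "admissible (Deletion P) s"
  defines "s' \<equiv> val (batch_delete build X P s)" and "m \<equiv> card (contents s) + length P"
  shows "valid s'"
    and "real (work (batch_delete build X P s)) + potential s'
      \<le> potential s + 8 * delete_cost * (real (length P) * weight (2 * m))"
    and "real (depth (batch_delete build X P s))
      \<le> real (60 + 12 * KD + (29 + 15 * X + 5 * b + KD)) * (lg m * log 2 (lg m))"
proof -
  have P: "P \<noteq> []" using adm by (simp add: admissible_def)
  obtain q where del: "valid s'" "flags s' \<le> flags s" "deficit X s' + q \<le> deficit X s + length P"
    "work (batch_delete build X P s) + insert_cost * credit (flags s')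
      \<le> insert_cost * credit (flags s) + delete_cost * (floorlog 2 (flags s) + 1)\<^sup>2 * (length P + q)"
    "depth (batch_delete build X P s)
      \<le> floorlog 2 (length P) + 19 * floorlog 2 (flags s)
        + KD * (floorlog 2 (flags s) * floorlog 2 (floorlog 2 (flags s))) + (29 + 15 * X + 5 * b + KD)"
    using batch_delete_bounds [OF valid P] unfolding s'_def delete_cost_def insert_cost_def by blast
  show "valid s'" by fact
  have flags: "flags s \<le> 2 * m"
    using flags_le_contents [OF valid] by (simp add: m_def)
  show "real (depth (batch_delete build X P s))
      \<le> real (60 + 12 * KD + (29 + 15 * X + 5 * b + KD)) * (lg m * log 2 (lg m))"
    using del(5) by (intro depth_le_lg [OF flags, of "length P"]) (auto simp: m_def)
  define w where "w = weight (flags s)"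
  define p where "p = real (length P)"
  have w: "1 \<le> w" by (simp add: w_def weight_ge_1)
  have "real (work (batch_delete build X P s) + insert_cost * credit (flags s'))
      \<le> real (insert_cost * credit (flags s) + delete_cost * (floorlog 2 (flags s) + 1)\<^sup>2 * (length P + q))"
    using del(4) by (rule of_nat_mono)
  then have "real (work (batch_delete build X P s)) + real insert_cost * real (credit (flags s'))
      \<le> real insert_cost * real (credit (flags s))
        + real delete_cost * ((real (floorlog 2 (flags s)) + 1)\<^sup>2 * (p + real q))"
    by (simp add: p_def add_ac mult.assoc)
  also have "(real (floorlog 2 (flags s)) + 1)\<^sup>2 * (p + real q) \<le> 4 * w * (p + real q)"
    unfolding w_def by (intro mult_right_mono floorlog2_square_le_weight) (simp add: p_def)
  finally have 1: "real (work (batch_delete build X P s)) + real insert_cost * real (credit (flags s'))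
      \<le> real insert_cost * real (credit (flags s)) + real delete_cost * (4 * w * (p + real q))"
    by (simp add: mult_left_mono)
  \<comment> \<open>In units of \<open>delete_cost\<close>, the \<open>4 * w * q\<close> for the
    reinserted points cancels against the fall of the deficit. What remains is
    \<open>8 * p * w\<close>: half for handling the batch, half for the deficit that it
    creates.\<close>
  have "real (deficit X s') * weight (flags s') \<le> (real (deficit X s) + p - real q) * w"
    using del(3) weight_mono [OF del(2)] weight_ge_1 [of "flags s'"] unfolding p_def w_def
    by (intro mult_mono) linarith+
  then have "4 * real delete_cost * (real (deficit X s') * weight (flags s'))
      \<le> 4 * real delete_cost * ((real (deficit X s) + p - real q) * w)"
    by (intro mult_left_mono) auto
  then have "real (work (batch_delete build X P s)) + potential s'
      \<le> real insert_cost * real (credit (flags s)) + real delete_cost * (4 * w * (p + real q))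
        + 4 * real delete_cost * ((real (deficit X s) + p - real q) * w)"
    using 1 unfolding potential_def by (simp add: mult.assoc)
  also have "\<dots> = potential s + 8 * real delete_cost * (p * w)"
    by (simp add: potential_def w_def algebra_simps)
  also have "\<dots> \<le> potential s + 8 * real delete_cost * (p * weight (2 * m))"
    using weight_mono [OF flags] by (intro add_left_mono mult_left_mono) (auto simp: w_def p_def)
  finally show "real (work (batch_delete build X P s)) + potential s'
      \<le> potential s + 8 * delete_cost * (real (length P) * weight (2 * m))"
    by (simp add: p_def)
qed

text \<open>One constant for work and depth of both kinds of update; the 9 comes from
  \<open>weight_le_lg\<close>.\<close>

definition update_cost :: real where
  "update_cost = real (9 * (14 + 7 * X + KW + 16 * insert_cost + 32 * delete_cost * X + 8 * delete_cost)
     + (60 + 12 * KD + (29 + 15 * X + 5 * b + KD)))"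

lemma update_bounds:
  assumes "valid s" "admissible u s"
  defines "s' \<equiv> val (exec build X u s)" and "m \<equiv> card (contents s) + length (batch u)"
  shows "valid s'"
    and "real (work (exec build X u s)) + potential s'
      \<le> potential s + update_cost * (real (length (batch u)) * (lg m)\<^sup>2)"
    and "real (depth (exec build X u s)) \<le> update_cost * (lg m * log 2 (lg m))"
proof -
  have l: "0 \<le> lg m * log 2 (lg m)"
    using lg_ge_2 [of m] log2_lg_ge_1 [of m] by simp
  have w: "K * (real (length (batch u)) * weight (2 * m)) \<le> update_cost * (real (length (batch u)) * (lg m)\<^sup>2)"
    if "0 \<le> K" "9 * K \<le> update_cost" for K
  proof -
    have "K * (real (length (batch u)) * weight (2 * m))
        \<le> K * (real (length (batch u)) * (9 * (lg m)\<^sup>2))"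
      using that weight_le_lg [of "2 * m" m] by (intro mult_left_mono) auto
    also have "\<dots> = 9 * K * (real (length (batch u)) * (lg m)\<^sup>2)" by simp
    also have "\<dots> \<le> update_cost * (real (length (batch u)) * (lg m)\<^sup>2)"
      using that by (intro mult_right_mono) auto
    finally show ?thesis .
  qed
  have d: "real K * (lg m * log 2 (lg m)) \<le> update_cost * (lg m * log 2 (lg m))" if "real K \<le> update_cost" for K
    using that l by (rule mult_right_mono)
  have all: "valid s' \<and>
    real (work (exec build X u s)) + potential s'
      \<le> potential s + update_cost * (real (length (batch u)) * (lg m)\<^sup>2) \<and>
    real (depth (exec build X u s)) \<le> update_cost * (lg m * log 2 (lg m))"
  proof (cases u)
    case (Insertion P)
    note ib = insertion_bounds [OF assms(1) assms(2) [unfolded Insertion]]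
    show ?thesis
      using ib w [of "real (14 + 7 * X + KW + 16 * insert_cost + 32 * delete_cost * X)"]
        d [of "60 + 12 * KD + (20 + 8 * X + 2 * b + KD)"]
      unfolding s'_def m_def Insertion by (simp add: update_cost_def)
  next
    case (Deletion P)
    note db = deletion_bounds [OF assms(1) assms(2) [unfolded Deletion]]
    show ?thesis
      using db w [of "real (8 * delete_cost)"] d [of "60 + 12 * KD + (29 + 15 * X + 5 * b + KD)"]
      unfolding s'_def m_def Deletion by (simp add: update_cost_def)
  qed
  then show "valid s'"
    and "real (work (exec build X u s)) + potential s'
      \<le> potential s + update_cost * (real (length (batch u)) * (lg m)\<^sup>2)"
    and "real (depth (exec build X u s)) \<le> update_cost * (lg m * log 2 (lg m))"
    by blast+
qed

section \<open>Summation over a sequence of updates\<close>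

lemma tree_list_empty_bdl: "tree_list empty_bdl i = []"
  by (simp add: tree_list_def empty_bdl_def)

lemma valid_empty: "valid empty_bdl"
  using X_pos by (simp add: valid_def tree_list_empty_bdl) (simp add: empty_bdl_def valid_buffer_def)

lemma potential_empty: "potential empty_bdl = 0"
proof -
  have "flags (empty_bdl :: 'd bdl) = 0" by (simp add: flags_def empty_bdl_def)
  then show ?thesis by (simp add: potential_def credit_def deficit_def level_credit_def)
qed

lemma state_before_Suc:
  "i < length us \<Longrightarrow>
    state_before build X us (Suc i) = val (exec build X (us ! i) (state_before build X us i))"
  by (simp add: state_before_def take_Suc_conv_app_nth)

text \<open>The potential differences telescope from 0 at the empty structure; validity is carried
  along because every bound for a single update assumes it.\<close>

lemma sequence_bounds:
  fixes us :: "'d update list"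
  assumes "\<And>i. i < length us \<Longrightarrow> admissible (us ! i) (state_before build X us i)"
    and "j \<le> length us"
  defines "m \<equiv> \<lambda>i. card (contents (state_before build X us i)) + length (batch (us ! i))"
  shows "valid (state_before build X us j) \<and>
    (\<Sum>i<j. real (work (exec build X (us ! i) (state_before build X us i))))
      + potential (state_before build X us j)
      \<le> update_cost * (\<Sum>i<j. real (length (batch (us ! i))) * (lg (m i))\<^sup>2)"
  using assms(2)
proof (induction j)
  case 0
  then show ?case
    by (simp add: state_before_def valid_empty potential_empty)
next
  case (Suc j)
  then have "j < length us" by simp
  with Suc have IH: "valid (state_before build X us j)"
    "(\<Sum>i<j. real (work (exec build X (us ! i) (state_before build X us i))))
      + potential (state_before build X us j)
      \<le> update_cost * (\<Sum>i<j. real (length (batch (us ! i))) * (lg (m i))\<^sup>2)" by auto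
  show ?case
    using update_bounds [OF IH(1) assms(1) [OF \<open>j < length us\<close>]] IH(2)
    unfolding state_before_Suc [OF \<open>j < length us\<close>]
    by (simp add: m_def distrib_left)
qed

end

text \<open>Landau bounds hold only from some size on; the finitely many smaller sizes are covered
  by the sums \<open>M\<close> and \<open>M'\<close>. For large sizes, \<open>m <= 2 ^ i * X\<close>
  gives \<open>log 2 m <= (i + 1) * (X + 1)\<close>, so each factor of the bound costs at most one
  factor \<open>x\<close>.\<close>

lemma kd_construction_exists:
  fixes build :: "'d::{finite,linorder} builder"
    and X b :: nat
    and W D :: "nat \<Rightarrow> real"
  assumes "0 < X" and "0 < b"
    and "kd_builder b build"
    and W: "\<And>ps. ps \<noteq> [] \<Longrightarrow> distinct ps \<Longrightarrow> real (work (build ps)) \<le> W (length ps)"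
    and D: "\<And>ps. ps \<noteq> [] \<Longrightarrow> distinct ps \<Longrightarrow> real (depth (build ps)) \<le> D (length ps)"
    and WO: "W \<in> O(\<lambda>m. real m * log 2 (real m))"
    and DO: "D \<in> O(\<lambda>m. log 2 (real m) * log 2 (log 2 (real m)))"
  shows "\<exists>KW KD. kd_construction build X b KW KD"
proof -
  obtain c where c: "0 < c"
    "eventually (\<lambda>m. norm (W m) \<le> c * norm (real m * log 2 (real m))) sequentially"
    using landau_o.bigE [OF WO] by blast
  then obtain N where N: "\<And>m. N \<le> m \<Longrightarrow> norm (W m) \<le> c * norm (real m * log 2 (real m))"
    by (auto simp: eventually_sequentially)
  obtain c' where c': "0 < c'"
    "eventually (\<lambda>m. norm (D m) \<le> c' * norm (log 2 (real m) * log 2 (log 2 (real m)))) sequentially"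
    using landau_o.bigE [OF DO] by blast
  then obtain N' where N': "\<And>m. N' \<le> m \<Longrightarrow> norm (D m) \<le> c' * norm (log 2 (real m) * log 2 (log 2 (real m)))"
    by (auto simp: eventually_sequentially)
  define x where "x = real X + 1"
  define M where "M = (\<Sum>m<N. \<bar>W m\<bar>)"
  \<comment> \<open>From size 4 on, \<open>log 2 m >= 2\<close>, so the double logarithm is
    nonnegative and the norm can be removed.\<close>
  define M' where "M' = (\<Sum>m<max N' 4. \<bar>D m\<bar>)"
  have M: "0 \<le> M" "0 \<le> M'" by (simp_all add: M_def M'_def sum_nonneg)
  have x: "1 \<le> x" by (simp add: x_def)
  have log_le: "log 2 (real m) \<le> (real i + 1) * x" if "1 \<le> m" "m \<le> 2 ^ i * X" for m i
  proof -
    have "m \<le> 2 ^ (i + X)"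
      using that(2) mult_le_mono2 [OF less_imp_le [OF less_exp [of X]], of "2 ^ i"]
      unfolding power_add by linarith
    then have "real m \<le> 2 powr real (i + X)"
      by (metis of_nat_le_iff of_nat_numeral of_nat_power powr_realpow zero_less_numeral)
    then have "log 2 (real m) \<le> real (i + X)"
      using that(1) by (subst log_le_iff) auto
    also have "\<dots> \<le> (real i + 1) * x" by (simp add: x_def algebra_simps)
    finally show ?thesis .
  qed
  have "kd_construction build X b (nat \<lceil>c * (x * x) + M\<rceil>) (nat \<lceil>c' * (x * x) + M'\<rceil>)"
  proof
    fix ps :: "'d pt list" and i
    assume ps: "ps \<noteq> []" "distinct ps" "length ps \<le> 2 ^ i * X"
    define m where "m = length ps"
    have m: "1 \<le> m" "m \<le> 2 ^ i * X" using ps by (auto simp: m_def Suc_le_eq)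
    have lm: "log 2 (real m) \<le> (real i + 1) * x" "0 \<le> log 2 (real m)"
      using log_le [OF m] m by auto
    define y where "y = 2 ^ i * (real i + 1)"
    have y: "1 \<le> y" unfolding y_def using mult_mono [of 1 "2 ^ i" 1 "real i + 1"] by simp
    have "W m \<le> (c * (x * x) + M) * y"
    proof (cases "N \<le> m")
      case True
      have "real m \<le> 2 ^ i * x"
      proof -
        have "real m \<le> real (2 ^ i * X)" using m(2) by (rule of_nat_mono)
        also have "\<dots> \<le> 2 ^ i * x" by (simp add: x_def)
        finally show ?thesis .
      qed
      then have "real m * log 2 (real m) \<le> (2 ^ i * x) * ((real i + 1) * x)"
        using lm x by (intro mult_mono) auto
      then have "c * (real m * log 2 (real m)) \<le> c * (x * x * y)"
        using c(1) by (intro mult_left_mono) (auto simp: y_def algebra_simps)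
      moreover have "W m \<le> c * (real m * log 2 (real m))"
        using N [OF True] lm by (simp add: abs_mult)
      moreover have "0 \<le> M * y" using M y by simp
      ultimately show ?thesis by (simp add: algebra_simps)
    next
      case False
      then have "\<bar>W m\<bar> \<le> M"
        unfolding M_def by (intro member_le_sum) auto
      also have "M \<le> M * y" using mult_left_mono [OF y M(1)] by simp
      also have "\<dots> \<le> (c * (x * x) + M) * y" using c(1) x y by (intro mult_right_mono) auto
      finally show ?thesis by simp
    qed
    also have "\<dots> \<le> real (nat \<lceil>c * (x * x) + M\<rceil>) * y"
      using y by (intro mult_right_mono) (auto intro: real_nat_ceiling_ge)
    also have "\<dots> = real (nat \<lceil>c * (x * x) + M\<rceil> * (2 ^ i * (i + 1)))"
      by (simp add: y_def algebra_simps)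
    finally have "real (work (build ps)) \<le> real (nat \<lceil>c * (x * x) + M\<rceil> * (2 ^ i * (i + 1)))"
      using W [OF ps(1,2)] by (simp add: m_def)
    then show "work (build ps) \<le> nat \<lceil>c * (x * x) + M\<rceil> * (2 ^ i * (i + 1))"
      by (rule of_nat_le_iff [THEN iffD1])
    define f where "f = real (floorlog 2 (i + 1))"
    define z where "z = (real i + 1) * f"
    have "0 < floorlog 2 (i + 1)" by (simp add: floorlog_def)
    then have f: "1 \<le> f" by (simp add: f_def)
    have z: "1 \<le> z" unfolding z_def using mult_mono [of 1 "real i + 1" 1 f] f by simp
    have log_i: "log 2 (real i + 1) \<le> f"
    proof -
      have "real (i + 1) < real (2 ^ floorlog 2 (i + 1))"
        using less_two_power_floorlog [of "i + 1"] by (rule of_nat_less_iff [THEN iffD2])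
      then have "real i + 1 \<le> 2 powr f" by (simp add: f_def powr_realpow)
      then show ?thesis by (subst log_le_iff) auto
    qed
    have "D m \<le> (c' * (x * x) + M') * z"
    proof (cases "max N' 4 \<le> m")
      case True
      have "log 2 4 \<le> log 2 (real m)"
        using True by (subst log_le_cancel_iff) auto
      then have l2: "2 \<le> log 2 (real m)" by (simp add: log_2_4)
      have "log 2 (log 2 (real m)) \<le> log 2 ((real i + 1) * x)"
        using l2 lm by (subst log_le_cancel_iff) auto
      also have "\<dots> = log 2 (real i + 1) + log 2 x"
        using x by (intro log_mult_pos) auto
      also have "log 2 x \<le> real X"
      proof -
        have "real (X + 1) \<le> real (2 ^ X)"
          using Suc_leI [OF less_exp [of X]] by (intro of_nat_mono) simp
        then have "x \<le> 2 powr real X" by (simp add: x_def powr_realpow)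
        then show ?thesis using x by (subst log_le_iff) auto
      qed
      also have "log 2 (real i + 1) + real X \<le> f * x"
        using log_i mult_left_mono [OF f, of "real X"] by (simp add: x_def algebra_simps)
      finally have "log 2 (log 2 (real m)) \<le> f * x" by simp
      moreover have ll: "0 \<le> log 2 (log 2 (real m))" using l2 by simp
      ultimately have "log 2 (real m) * log 2 (log 2 (real m)) \<le> ((real i + 1) * x) * (f * x)"
        using lm x by (intro mult_mono) auto
      then have "c' * (log 2 (real m) * log 2 (log 2 (real m))) \<le> c' * (x * x * z)"
        using c'(1) by (intro mult_left_mono) (auto simp: z_def algebra_simps)
      moreover have "D m \<le> c' * (log 2 (real m) * log 2 (log 2 (real m)))"
        using N' [of m] True lm ll by (simp add: abs_mult)
      moreover have "0 \<le> M' * z" using M z by simp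
      ultimately show ?thesis by (simp add: algebra_simps)
    next
      case False
      then have "\<bar>D m\<bar> \<le> M'"
        unfolding M'_def by (intro member_le_sum) auto
      also have "M' \<le> M' * z" using mult_left_mono [OF z M(2)] by simp
      also have "\<dots> \<le> (c' * (x * x) + M') * z" using c'(1) x z by (intro mult_right_mono) auto
      finally show ?thesis by simp
    qed
    also have "\<dots> \<le> real (nat \<lceil>c' * (x * x) + M'\<rceil>) * z"
      using z by (intro mult_right_mono) (auto intro: real_nat_ceiling_ge)
    also have "\<dots> = real (nat \<lceil>c' * (x * x) + M'\<rceil> * ((i + 1) * floorlog 2 (i + 1)))"
      by (simp add: z_def f_def algebra_simps)
    finally have "real (depth (build ps)) \<le> real (nat \<lceil>c' * (x * x) + M'\<rceil> * ((i + 1) * floorlog 2 (i + 1)))"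
      using D [OF ps(1,2)] by (simp add: m_def)
    then show "depth (build ps) \<le> nat \<lceil>c' * (x * x) + M'\<rceil> * ((i + 1) * floorlog 2 (i + 1))"
      by (rule of_nat_le_iff [THEN iffD1])
  qed (use assms in auto)
  then show ?thesis by blast
qed

theorem theorem4:
  fixes build :: "'d::{finite,linorder} builder"
    and X b :: nat
    and W D :: "nat \<Rightarrow> real"
  assumes "0 < X" and "0 < b"
    and "kd_builder b build"
    and "\<And>ps. ps \<noteq> [] \<Longrightarrow> distinct ps \<Longrightarrow> real (work (build ps)) \<le> W (length ps)"
    and "\<And>ps. ps \<noteq> [] \<Longrightarrow> distinct ps \<Longrightarrow> real (depth (build ps)) \<le> D (length ps)"
    and "W \<in> O(\<lambda>m. real m * log 2 (real m))"
    and "D \<in> O(\<lambda>m. log 2 (real m) * log 2 (log 2 (real m)))"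
  shows "\<exists>C. \<forall>us :: 'd update list.
    (\<forall>i<length us. admissible (us ! i) (state_before build X us i)) \<longrightarrow>
    (let B = (\<lambda>i. length (batch (us ! i)));
         n = (\<lambda>i. card (contents (state_before build X us i)));
         cost = (\<lambda>i. exec build X (us ! i) (state_before build X us i))
     in (\<Sum>i<length us. real (work (cost i)))
          \<le> C * (\<Sum>i<length us. real (B i) * (lg (n i + B i))\<^sup>2) \<and>
        (\<forall>i<length us.
          real (depth (cost i)) \<le> C * (lg (n i + B i) * log 2 (lg (n i + B i)))))"
proof -
  obtain KW KD where kd: "kd_construction build X b KW KD"
    using kd_construction_exists [OF assms] by blast
  interpret kd_construction build X b KW KD by (rule kd)
  show ?thesis
    unfolding Let_def
  proof (intro exI allI impI conjI)
    fix us :: "'d update list"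
    assume adm: "\<forall>i<length us. admissible (us ! i) (state_before build X us i)"
    show "(\<Sum>i<length us. real (work (exec build X (us ! i) (state_before build X us i))))
      \<le> update_cost * (\<Sum>i<length us. real (length (batch (us ! i))) *
          (lg (card (contents (state_before build X us i)) + length (batch (us ! i))))\<^sup>2)"
      using sequence_bounds [of us "length us"] adm potential_nonneg [of "state_before build X us (length us)"]
      by simp
    fix i assume i: "i < length us"
    have "valid (state_before build X us i)"
      using sequence_bounds [of us i] adm i by simp
    then show "real (depth (exec build X (us ! i) (state_before build X us i)))
      \<le> update_cost * (lg (card (contents (state_before build X us i)) + length (batch (us ! i))) *
          log 2 (lg (card (contents (state_before build X us i)) + length (batch (us ! i)))))"
      using update_bounds(3) adm i by blast
  qed
qed

end
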